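(* Let $\mathbb F$ be a field. (a) Let $M,N$ be commuting nilpotent $n\times n$ matrices over $\mathbb F$ whose common null space $\mathcal N(M,N)=\{v\in\mathbb F^n : Mv=Nv=0\}$ is one-dimensional. Let the Jordan canonical form of $M$ consist of exactly $p_s$ Jordan blocks $J_{k_s}(0)$ for $s=1,\dots,t$, where $k_1>k_2>\dots>k_t>0$ and all $p_s\ge 1$. Put $k:=k_1$, let $r_1\ge\dots\ge r_k$ be the Weyr characteristic of $M$ and $W$ its Weyr canonical form. Then $(M,N)$ is similar to a pair $(W,B)$, where $B=[\underline B_{\alpha\beta}]_{\alpha,\beta=1}^{k}$ is partitioned into blocks $\underline B_{\alpha\beta}$ of size $r_\alpha\times r_\beta$ such that: - $\underline B_{\alpha\beta}=0$ if $\alpha>\beta$, and $\underline B_{\alpha\alpha}=J_{r_\alpha}(0)$ for all $\alpha=1,\dots,k$; - for each $j=2,\dots,k$, all nonzero entries of $\underline B_{1j}$ are located on the stairs of the $(1,j)$ block (the stairs being determined by $W$ as specified in the context); - for each $j\ge 2$ and $l\ge 1$ with $j+l\le k$, $\underline B_{1+l,j+l}$ is the $r_{1+l}\times r_{j+l}$ submatrix of $\underline B_{1j}$ located in its upper left corner. (b) In particular, let $M,N$ be commuting nilpotent matrices over $\mathbb F$ whose common null space is one-dimensional, and suppose that the Jordan canonical form of $M$ is $J_k(0)\oplus\dots\oplus J_k(0)$ ($r$ summands). Then $(M,N)$ is similar to a pair of the form $$ (W,B)=\left(\begin{bmatrix}0_r&I_r&&&0_r\\ &0_r&I_r&&\\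 &&0_r&\ddots&\\ &&&\ddots&I_r\\ 0_r&&&&0_r\end{bmatrix},\ \begin{bmatrix}J_r(0)&B_1&B_2&\cdots&B_{k-1}\\ &J_r(0)&B_1&\ddots&\vdots\\ &&J_r(0)&\ddots&B_2\\ &&&\ddots&B_1\\ 0_r&&&&J_r(0)\end{bmatrix}\right) $$ ($k\times k$ block matrices with $r\times r$ blocks; $B$ is block upper triangular and block Toeplitz), in which every $B_i$ is an $r\times r$ matrix whose last row is arbitrary and whose other rows are zero. If the characteristic of $\mathbb F$ is zero, then this pair is uniquely determined by $(M,N)$; that is, if $(M,N)$ is similar to two pairs $(W,B)$ and $(W,B')$ of this form, then $B=B'$.
   Context: Two pairs of $n\times n$ matrices $(M,N)$ and $(M',N')$ over $\mathbb F$ are similar if there is a nonsingular matrix $S$ over $\mathbb F$ with $S^{-1}MS=M'$ and $S^{-1}NS=N'$. $J_m(0)$ is the $m\times m$ nilpotent Jordan block with ones on the first superdiagonal and zeros elsewhere; $0_m$ and $I_m$ are the $m\times m$ zero and identity matrices. Weyr canonical form. Let $M$ be nilpotent with Jordan canonical form consisting of $p_s$ blocks $J_{k_s}(0)$, $s=1,\dots,t$, $k_1>\dots>k_t>0$, $p_s\ge1$. For $1\le i\le k:=k_1$, let $r_i$ be the number of Jordan blocks of size at least $i\times i$; the sequence $r_1\ge\dots\ge r_k$ is the Weyr characteristic of $M$. The Weyr canonical form of $M$ is the $k\times k$ block matrix $W$ whose $(\alpha,\beta)$ block has size $r_\alpha\times r_\beta$, whose $(\alpha,\alpha+1)$ block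 is $\begin{bmatrix}I_{r_{\alpha+1}}\\0\end{bmatrix}$ for $\alpha=1,\dots,k-1$, and all of whose other blocks are zero. It is permutation similar to the Jordan canonical form of $M$. Stairs. For $1\le\alpha\le k$ let $m_\alpha$ be the number of $s\in\{1,\dots,t\}$ with $k_s\ge\alpha$; then $m_1=t$ and $r_\alpha=p_1+\dots+p_{m_\alpha}$. For $1\le j\le k$, partition an $r_1\times r_j$ matrix into $t$ horizontal strips of heights $p_1,\dots,p_t$ and $m_j$ vertical strips of widths $p_1,\dots,p_{m_j}$. Call a position of this $r_1\times r_j$ matrix free if it lies in the intersection of the $a$-th horizontal strip and the $b$-th vertical strip with $k_b-k_a\le j-1$. (The free positions are exactly those at which the $(1,j)$ block of a matrix commuting with $W$ can have nonzero entries; they form a staircase region: every position above or to the right of a free position is free.) A position is on the stairs of the $(1,j)$ block if it is the lowest free position in its column. Equivalently, in the $b$-th vertical strip the positions on the stairs are those in the last row of the $a$-th horizontal strip, where $a$ is the largest index in $\{1,\dots,t\}$ with $k_b-k_a\le j-1$. *)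

theory Defs
  imports
    "Jordan_Normal_Form.Jordan_Normal_Form"
    "Jordan_Normal_Form.Matrix_Kernel"
    "Jordan_Normal_Form.DL_Submatrix"
    "HOL-Computational_Algebra.Computational_Algebra"
begin

definition nilpotent_mat :: "'a :: semiring_1 mat \<Rightarrow> bool" where
  "nilpotent_mat A \<longleftrightarrow> (\<exists>e. A ^\<^sub>m e = 0\<^sub>m (dim_row A) (dim_row A))"

definition common_null_space :: "'a :: comm_ring_1 mat \<Rightarrow> 'a mat \<Rightarrow> 'a vec set" where
  "common_null_space M N = mat_kernel M \<inter> mat_kernel N"

definition subspace_dim :: "nat \<Rightarrow> 'a :: field vec set \<Rightarrow> nat" where
  "subspace_dim n U = vectorspace.dim class_ring (module_vec TYPE('a) n\<lparr>carrier := U\<rparr>)"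

(* similar_mat_wit M' M S' S says that S' and S are mutually inverse and M' = S' * M * S,
   so both conjugations are by the same S, and S' is the inverse of S. *)
definition similar_pair :: "'a :: semiring_1 mat \<times> 'a mat \<Rightarrow> 'a mat \<times> 'a mat \<Rightarrow> bool" where
  "similar_pair P Q \<longleftrightarrow> (\<exists>S S'.
     similar_mat_wit (fst Q) (fst P) S' S \<and> similar_mat_wit (snd Q) (snd P) S' S)"


(* Partitions of an index range into consecutive strips: strips are numbered 1, 2, ... and
   strip s has size h s, whereas matrix rows and columns are numbered from 0. *)

definition strip_start :: "(nat \<Rightarrow> nat) \<Rightarrow> nat \<Rightarrow> nat" where
  "strip_start h s = (\<Sum>u = 1..<s. h u)"

definition strip_of :: "(nat \<Rightarrow> nat) \<Rightarrow> nat \<Rightarrow> nat" where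
  "strip_of h i = (LEAST s. i < (\<Sum>u = 1..s. h u))"

definition block_of :: "(nat \<Rightarrow> nat) \<Rightarrow> 'a mat \<Rightarrow> nat \<Rightarrow> nat \<Rightarrow> 'a mat" where
  "block_of r B \<alpha> \<beta> = submatrix B {strip_start r \<alpha> ..< strip_start r \<alpha> + r \<alpha>}
                                   {strip_start r \<beta> ..< strip_start r \<beta> + r \<beta>}"

definition upper_left_corner :: "nat \<Rightarrow> nat \<Rightarrow> 'a mat \<Rightarrow> 'a mat" where
  "upper_left_corner a b A = submatrix A {..<a} {..<b}"

(* The k x k block matrix with (alpha,beta) block F alpha beta of size r alpha x r beta. *)
definition block_mat :: "(nat \<Rightarrow> nat) \<Rightarrow> nat \<Rightarrow> (nat \<Rightarrow> nat \<Rightarrow> 'a mat) \<Rightarrow> 'a mat" where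
  "block_mat r k F = mat (\<Sum>\<alpha> = 1..k. r \<alpha>) (\<Sum>\<alpha> = 1..k. r \<alpha>) (\<lambda>(i, j).
     F (strip_of r i) (strip_of r j)
       $$ (i - strip_start r (strip_of r i), j - strip_start r (strip_of r j)))"


definition jordan_blocks :: "nat \<Rightarrow> (nat \<Rightarrow> nat) \<Rightarrow> (nat \<Rightarrow> nat) \<Rightarrow> (nat \<times> 'a :: zero) list" where
  "jordan_blocks t ks ps = concat (map (\<lambda>s. replicate (ps s) (ks s, 0)) [1..<t + 1])"

definition weyr_char :: "(nat \<times> 'a) list \<Rightarrow> nat \<Rightarrow> nat" where
  "weyr_char n_as i = length (filter (\<lambda>(m, a). i \<le> m) n_as)"

(* r is the Weyr characteristic, and k the size of the largest Jordan block. *)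
definition weyr_mat :: "(nat \<Rightarrow> nat) \<Rightarrow> nat \<Rightarrow> 'a :: zero_neq_one mat" where
  "weyr_mat r k = block_mat r k (\<lambda>\<alpha> \<beta>.
     mat (r \<alpha>) (r \<beta>) (\<lambda>(i, j). if \<beta> = \<alpha> + 1 \<and> i = j then 1 else 0))"

(* Position (i, c), numbered from 0, of the r 1 x r j matrix in block (1,j). Its rows and columns
   are both cut into strips of sizes ps 1, ps 2, ...; as r j = ps 1 + ... + ps m for the number m
   of those s with ks s >= j, the columns c < r j fill exactly the first m vertical strips. *)
definition free_position ::
  "(nat \<Rightarrow> nat) \<Rightarrow> (nat \<Rightarrow> nat) \<Rightarrow> (nat \<Rightarrow> nat) \<Rightarrow> nat \<Rightarrow> nat \<Rightarrow> nat \<Rightarrow> bool" where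
  "free_position ks ps r j i c \<longleftrightarrow> i < r 1 \<and> c < r j \<and>
     int (ks (strip_of ps c)) - int (ks (strip_of ps i)) \<le> int j - 1"

definition on_stairs ::
  "(nat \<Rightarrow> nat) \<Rightarrow> (nat \<Rightarrow> nat) \<Rightarrow> (nat \<Rightarrow> nat) \<Rightarrow> nat \<Rightarrow> nat \<Rightarrow> nat \<Rightarrow> bool" where
  "on_stairs ks ps r j i c \<longleftrightarrow> free_position ks ps r j i c \<and>
     (\<forall>i'. i < i' \<longrightarrow> \<not> free_position ks ps r j i' c)"


definition shift_block_mat :: "nat \<Rightarrow> nat \<Rightarrow> 'a :: {zero, one} mat" where
  "shift_block_mat r k = block_mat (\<lambda>_. r) k (\<lambda>\<alpha> \<beta>. if \<beta> = \<alpha> + 1 then 1\<^sub>m r else 0\<^sub>m r r)"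

definition toeplitz_block_mat :: "nat \<Rightarrow> nat \<Rightarrow> (nat \<Rightarrow> 'a :: {zero, one} mat) \<Rightarrow> 'a mat" where
  "toeplitz_block_mat r k C = block_mat (\<lambda>_. r) k (\<lambda>\<alpha> \<beta>.
     if \<beta> < \<alpha> then 0\<^sub>m r r else if \<beta> = \<alpha> then jordan_block r 0 else C (\<beta> - \<alpha>))"

definition last_row_toeplitz :: "nat \<Rightarrow> nat \<Rightarrow> 'a :: {zero, one} mat \<Rightarrow> bool" where
  "last_row_toeplitz r k B \<longleftrightarrow> (\<exists>C. B = toeplitz_block_mat r k C \<and>
     (\<forall>i\<in>{1..k - 1}. C i \<in> carrier_mat r r \<and>
        (\<forall>a b. a + 1 < r \<longrightarrow> b < r \<longrightarrow> C i $$ (a, b) = 0)))"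


lemma strip_start_Suc: "1 \<le> s \<Longrightarrow> strip_start h (Suc s) = strip_start h s + h s"
  by (simp add: strip_start_def)

lemma strip_start_mono: "s \<le> s' \<Longrightarrow> strip_start h s \<le> strip_start h s'"
  unfolding strip_start_def by (rule sum_mono2) auto

lemma sum_eq_strip_start: "(\<Sum>u = 1..s. h u) = strip_start h (Suc s)"
  unfolding strip_start_def by (simp add: atLeastLessThanSuc_atLeastAtMost)

lemma strip_of_eq:
  assumes "1 \<le> s" "a < h s"
  shows "strip_of h (strip_start h s + a) = s"
  unfolding strip_of_def
proof (rule Least_equality)
  show "strip_start h s + a < (\<Sum>u = 1..s. h u)"
    unfolding sum_eq_strip_start strip_start_Suc[OF assms(1)] using assms(2) by linarith
next
  fix y assume y: "strip_start h s + a < (\<Sum>u = 1..y. h u)"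
  show "s \<le> y"
  proof (rule ccontr)
    assume "\<not> s \<le> y"
    then have "strip_start h (Suc y) \<le> strip_start h s" by (intro strip_start_mono) simp
    then show False using y unfolding sum_eq_strip_start by linarith
  qed
qed

lemma pick_interval: "i < h \<Longrightarrow> pick {a..<a + h} i = a + i"
proof (induction i)
  case 0
  show ?case unfolding pick.simps by (rule Least_equality) (use 0 in simp_all)
next
  case (Suc i)
  then have IH: "pick {a..<a + h} i = a + i" by simp
  show ?case unfolding pick.simps IH by (rule Least_equality) (use Suc.prems in simp_all)
qed

lemma submatrix_interval:
  assumes "a + h \<le> dim_row A" "b + w \<le> dim_col A"
  shows "submatrix A {a..<a + h} {b..<b + w} = mat h w (\<lambda>(i, j). A $$ (a + i, b + j))"
proof -
  have "{i. i < dim_row A \<and> i \<in> {a..<a + h}} = {a..<a + h}" using assms(1) by auto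
  then have 1: "card {i. i < dim_row A \<and> i \<in> {a..<a + h}} = h"
    by (metis card_atLeastLessThan add_diff_cancel_left')
  have "{j. j < dim_col A \<and> j \<in> {b..<b + w}} = {b..<b + w}" using assms(2) by auto
  then have 2: "card {j. j < dim_col A \<and> j \<in> {b..<b + w}} = w"
    by (metis card_atLeastLessThan add_diff_cancel_left')
  show ?thesis unfolding submatrix_def 1 2 by (rule eq_matI) (simp_all add: pick_interval)
qed

lemma block_of_block_mat:
  assumes \<alpha>: "\<alpha> \<in> {1..k}" and \<beta>: "\<beta> \<in> {1..k}" and F: "F \<alpha> \<beta> \<in> carrier_mat (r \<alpha>) (r \<beta>)"
  shows "block_of r (block_mat r k F) \<alpha> \<beta> = F \<alpha> \<beta>"
proof -
  have le: "strip_start r s + r s \<le> (\<Sum>u = 1..k. r u)" if "s \<in> {1..k}" for s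
  proof -
    have "1 \<le> s" "Suc s \<le> Suc k" using that by auto
    then show ?thesis
      unfolding sum_eq_strip_start using strip_start_mono strip_start_Suc by metis
  qed
  have lt: "strip_start r s + i < (\<Sum>u = 1..k. r u)" if "s \<in> {1..k}" "i < r s" for s i
    using le[OF that(1)] that(2) by linarith
  have "block_of r (block_mat r k F) \<alpha> \<beta> =
      mat (r \<alpha>) (r \<beta>) (\<lambda>(i, j). block_mat r k F $$ (strip_start r \<alpha> + i, strip_start r \<beta> + j))"
    unfolding block_of_def
    by (rule submatrix_interval) (use le[OF \<alpha>] le[OF \<beta>] in \<open>simp_all add: block_mat_def\<close>)
  also have "\<dots> = F \<alpha> \<beta>"
  proof (rule eq_matI)
    fix i j assume ij: "i < dim_row (F \<alpha> \<beta>)" "j < dim_col (F \<alpha> \<beta>)"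
    then have i: "i < r \<alpha>" and j: "j < r \<beta>" using F by auto
    show "mat (r \<alpha>) (r \<beta>) (\<lambda>(i, j). block_mat r k F $$
        (strip_start r \<alpha> + i, strip_start r \<beta> + j)) $$ (i, j) = F \<alpha> \<beta> $$ (i, j)"
      using i j lt[OF \<alpha> i] lt[OF \<beta> j] \<alpha> \<beta> by (simp add: block_mat_def strip_of_eq)
  qed (use F in auto)
  finally show ?thesis .
qed

end

theory Submission
  imports
    Defs
    "Jordan_Normal_Form.Jordan_Normal_Form_Uniqueness"
begin

text \<open>
  Since the common null space is a line, some coordinate functional \<open>w\<close> does not vanish on it, and then
  every functional on the space has the form \<open>w p(M, N)\<close> for a polynomial \<open>p\<close>. So the dual space is
  \<open>F[x, y]/I\<close> with \<open>I = {p. w p(M, N) = 0}\<close>, where \<open>x\<close> and \<open>y\<close> act as \<open>M\<close> and \<open>N\<close>. As a module over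
  \<open>F[x]\<close> this quotient is the direct sum of cyclic modules generated by polynomials \<open>f 0 = 1, f 1, f 2, \<dots>\<close>,
  monic in \<open>y\<close> of degrees \<open>0, 1, 2, \<dots>\<close>, whose orders \<open>x^(e c)\<close> decrease. One gets \<open>f (c + 1)\<close> from
  \<open>y f c\<close> by subtracting the multiples of the earlier generators that prevent \<open>x^(e (c + 1))\<close> from
  annihilating it; these corrections are nonzero only where the exponent drops, and their
  exponents of \<open>x\<close> are exactly those of the stairs. The functionals \<open>w x^m f c\<close> with \<open>m < e c\<close>, sorted
  by \<open>m\<close> first, are the rows of the required base change.

  When all blocks have the same size \<open>k\<close>, the \<open>r\<close>-th row of \<open>B\<close> expresses \<open>y^r\<close> in the basis
  \<open>1, \<dots>, y^(r - 1)\<close> over \<open>F[x]/(x^k)\<close>. This relation between \<open>M\<close> and \<open>N\<close> is invariant under similarity,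
  whence the uniqueness.
\<close>

hide_const (open) Module.smult

section \<open>Ideals of F[x, y] containing powers of x and y\<close>

text \<open>An invertible lowest coefficient would turn x^(e - 1 - m) h into a unit times x^(e - 1)
  plus a multiple of x^e, and put x^(e - 1) into \<open>J\<close>. The coefficient ring is general
  because the lemma serves twice: over F for ideals of F[x], and over F[x] for ideals of
  F[x][y].\<close>

lemma lowest_coeff_not_unit:
  fixes J :: "'a :: comm_ring_1 poly set"
  assumes mult: "\<And>p q. p \<in> J \<Longrightarrow> q * p \<in> J"
    and diff: "\<And>p q. p \<in> J \<Longrightarrow> q \<in> J \<Longrightarrow> p - q \<in> J"
    and e: "monom 1 e \<in> J" and least: "\<And>m. m < e \<Longrightarrow> monom 1 m \<notin> J"
    and h: "h \<in> J" and low: "\<And>l. l < m \<Longrightarrow> coeff h l = 0" and m: "m < e"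
  shows "\<not> coeff h m dvd 1"
proof
  assume "coeff h m dvd 1"
  then obtain d where d: "coeff h m * d = 1" by (metis dvdE)
  have "monom 1 m dvd h" using low by (simp add: monom_1_dvd_iff')
  then obtain g where g: "h = monom 1 m * g" by (elim dvdE)
  obtain c s where cs: "g = pCons c s" by (cases g)
  have "coeff h m = coeff g 0" unfolding g by (simp add: coeff_monom_mult)
  then have c: "c * d = 1" using d by (simp add: cs)
  define l where "l = e - 1 - m"
  have e_eq: "e = Suc (l + m)" using m by (simp add: l_def)
  have "g = [:c:] + monom 1 1 * s" unfolding cs by (simp add: monom_altdef)
  then have "monom 1 l * h = [:c:] * monom 1 (l + m) + s * monom 1 e"
    unfolding g e_eq by (simp add: mult_monom algebra_simps monom_Suc monom_0)
  then have "monom 1 (l + m) = [:d:] * (monom 1 l * h - s * monom 1 e)"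
    using c by (simp add: mult.commute[of d c])
  also have "\<dots> \<in> J"
    by (intro mult diff h e)
  finally show False using least[of "l + m"] e_eq by blast
qed

text \<open>Over a field a non-unit is zero, so the coefficients below \<open>e\<close> vanish one
  after the other.\<close>

lemma monom_dvd_of_mem_ideal:
  fixes J :: "'a :: field poly set"
  assumes mult: "\<And>p q. p \<in> J \<Longrightarrow> q * p \<in> J"
    and diff: "\<And>p q. p \<in> J \<Longrightarrow> q \<in> J \<Longrightarrow> p - q \<in> J"
    and e: "monom 1 e \<in> J" and least: "\<And>m. m < e \<Longrightarrow> monom 1 m \<notin> J"
    and h: "h \<in> J"
  shows "monom 1 e dvd h"
proof -
  have "coeff h m = 0" if "m < e" for m
    using that
  proof (induction m rule: less_induct)
    case (less m)
    then show ?case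
      using lowest_coeff_not_unit[OF mult diff e least h, of m] by (force simp: dvd_field_iff)
  qed
  then show ?thesis by (simp add: monom_1_dvd_iff')
qed

lemma monom_split:
  assumes "\<And>l. l < a \<Longrightarrow> coeff h l = 0" "a \<le> b"
  shows "h = monom 1 a * poly_cutoff (b - a) (poly_shift a h) + monom 1 b * poly_shift b (h :: 'a :: comm_semiring_1 poly)"
  using assms by (intro poly_eqI) (auto simp: coeff_monom_mult coeff_poly_cutoff coeff_poly_shift)

section \<open>Combinations over F[x] of polynomials in y\<close>

definition varY :: "'a :: comm_semiring_1 poly poly" where "varY = [:0, 1:]"

definition comb :: "nat \<Rightarrow> (nat \<Rightarrow> 'a :: comm_ring_1 poly) \<Rightarrow> (nat \<Rightarrow> 'a poly poly) \<Rightarrow> 'a poly poly" where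
  "comb i h f = (\<Sum>c<i. smult (h c) (f c))"

lemma comb_add: "comb i (\<lambda>c. h c + h' c) f = comb i h f + comb i h' f"
  by (simp add: comb_def smult_add_left sum.distrib)

lemma comb_diff: "comb i (\<lambda>c. h c - h' c) f = comb i h f - comb i h' f"
  by (simp add: comb_def smult_diff_left sum_subtractf)

lemma comb_smult: "comb i (\<lambda>c. a * h c) f = smult a (comb i h f)"
  by (simp add: comb_def smult_sum2)

lemma comb_Suc: "comb (Suc i) h f = comb i h f + smult (h i) (f i)"
  by (simp add: comb_def)

lemma comb_0 [simp]: "comb i (\<lambda>_. 0) f = 0"
  by (simp add: comb_def)

lemma comb_single: "j < i \<Longrightarrow> comb i (\<lambda>c. if c = j then a else 0) f = smult a (f j)"
proof -
  assume "j < i"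
  have "comb i (\<lambda>c. if c = j then a else 0) f = (\<Sum>c<i. if c = j then smult a (f c) else 0)"
    unfolding comb_def by (rule sum.cong) auto
  then show ?thesis using \<open>j < i\<close> by simp
qed

lemma comb_cong: "(\<And>c. c < i \<Longrightarrow> h c = h' c) \<Longrightarrow> (\<And>c. c < i \<Longrightarrow> f c = f' c) \<Longrightarrow> comb i h f = comb i h' f'"
  by (simp add: comb_def)

text \<open>The outer variable is y: \<open>[:monom 1 K:]\<close> is x^K, whereas
  \<open>monom 1 K\<close> is y^K.\<close>

locale nil_ideal =
  fixes I :: "'a :: field poly poly set" and K :: nat
  assumes add: "p \<in> I \<Longrightarrow> q \<in> I \<Longrightarrow> p + q \<in> I"
    and mult: "p \<in> I \<Longrightarrow> q * p \<in> I"
    and monX: "[:monom 1 K:] \<in> I"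
    and monY: "monom 1 K \<in> I"
begin

lemma zero: "0 \<in> I" using mult[OF monX, of 0] by simp

lemma uminus: "p \<in> I \<Longrightarrow> - p \<in> I" using mult[of p "-1"] by simp

lemma diff: "p \<in> I \<Longrightarrow> q \<in> I \<Longrightarrow> p - q \<in> I" using add[of p "-q"] uminus by simp

lemma smult: "p \<in> I \<Longrightarrow> smult a p \<in> I" using mult[of p "[:a:]"] by simp

lemma comb: "(\<And>c. c < i \<Longrightarrow> smult (h c) (f c) \<in> I) \<Longrightarrow> comb i h f \<in> I"
  unfolding comb_def by (induction i) (auto intro: zero add)

lemma add_cancel: "q \<in> I \<Longrightarrow> p + q \<in> I \<longleftrightarrow> p \<in> I"
  using add[of p q] diff[of "p + q" q] by auto

lemma smult_monom_mono: "smult (monom 1 a) p \<in> I \<Longrightarrow> a \<le> b \<Longrightarrow> smult (monom 1 b) p \<in> I"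
  using smult[of "smult (monom 1 a) p" "monom 1 (b - a)"] by (simp add: mult_monom)

lemma smult_dvd: "smult a p \<in> I \<Longrightarrow> a dvd b \<Longrightarrow> smult b p \<in> I"
  using smult[of "smult a p"] by (auto elim!: dvdE simp: mult.commute[of a])

text \<open>The source of all exponents \<open>e c\<close>: they are the orders of elements of a
  module over F[x] on which x is nilpotent.\<close>

lemma order_least:
  fixes J :: "'a poly set"
  assumes mult: "\<And>p q. p \<in> J \<Longrightarrow> q * p \<in> J"
    and diff: "\<And>p q. p \<in> J \<Longrightarrow> q \<in> J \<Longrightarrow> p - q \<in> J"
    and a: "monom 1 a \<in> J"
  obtains e where "e \<le> a" "monom 1 e \<in> J" "\<And>h. h \<in> J \<Longrightarrow> monom (1 :: 'a) e dvd h"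
proof -
  define e where "e = (LEAST e. monom 1 e \<in> J)"
  have 1: "monom 1 e \<in> J" unfolding e_def by (rule LeastI, rule a)
  have 2: "\<And>m. m < e \<Longrightarrow> monom 1 m \<notin> J" unfolding e_def by (rule not_less_Least)
  show ?thesis
  proof (rule that[of e])
    show "e \<le> a" unfolding e_def by (rule Least_le, rule a)
    show "monom 1 e dvd h" if "h \<in> J" for h
      using mult diff 1 2 that by (rule monom_dvd_of_mem_ideal)
  qed (rule 1)
qed

end

text \<open>
  A polynomial in \<open>y\<close> over \<open>F[x]\<close> has type \<open>'a poly poly\<close>; \<open>monom 1 m\<close> in \<open>smult (monom 1 m)\<close> is \<open>x^m\<close>.
  The last condition places the corrections \<open>q\<close> on the stairs.
\<close>
locale stair_basis = nil_ideal I K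
  for I :: "'a :: field poly poly set" and K :: nat +
  fixes i :: nat and f :: "nat \<Rightarrow> 'a poly poly" and e :: "nat \<Rightarrow> nat"
    and q :: "nat \<Rightarrow> nat \<Rightarrow> 'a poly"
  assumes f_0: "f 0 = 1"
    and f_Suc: "j < i \<Longrightarrow> f (Suc j) = varY * f j - comb (Suc j) (q j) f"
    and kill: "c \<le> i \<Longrightarrow> smult (monom 1 (e c)) (f c) \<in> I"
    and e_Suc: "c < i \<Longrightarrow> e (Suc c) \<le> e c"
    and indep: "comb (Suc i) h f \<in> I \<Longrightarrow> c \<le> i \<Longrightarrow> monom 1 (e c) dvd h c"
    and supp: "j < i \<Longrightarrow> c \<le> j \<Longrightarrow> coeff (q j c) m \<noteq> 0 \<Longrightarrow> e c - e j \<le> m \<and> m < e c - e (Suc j)"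
begin

lemma e_antimono:
  assumes "c \<le> d" "d \<le> i"
  shows "e d \<le> e c"
  using assms by (induction rule: dec_induct) (auto intro: order_trans[OF e_Suc])

text \<open>The next exponent e' is the order of y f_i modulo the span of the generators so far;
  \<open>J\<close> is the ideal of multipliers that bring \<open>varY * f i\<close> into this span.
  The coefficients of the resulting relation can be divided by x^e', up to terms that kill the
  generators, and the quotients are the corrections.\<close>

lemma extend: "\<exists>f e q. stair_basis I K (Suc i) f e q"
proof -
  have anti': "e i \<le> e c" if "c \<le> i" for c
    using that by (rule e_antimono) simp
  define J where "J = {g. \<exists>h. smult g (varY * f i) - comb (Suc i) h f \<in> I}"
  have J1: "b * a \<in> J" if "a \<in> J" for a b
  proof -
    obtain h where "smult a (varY * f i) - comb (Suc i) h f \<in> I"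
      using \<open>a \<in> J\<close> by (auto simp: J_def)
    from smult[OF this, of b] have "smult (b * a) (varY * f i) - comb (Suc i) (\<lambda>c. b * h c) f \<in> I"
      by (simp add: smult_diff_right comb_smult)
    then show ?thesis by (auto simp: J_def)
  qed
  have J2: "a - b \<in> J" if "a \<in> J" "b \<in> J" for a b
  proof -
    obtain h where h: "smult a (varY * f i) - comb (Suc i) h f \<in> I"
      using \<open>a \<in> J\<close> by (auto simp: J_def)
    obtain h' where h': "smult b (varY * f i) - comb (Suc i) h' f \<in> I"
      using \<open>b \<in> J\<close> by (auto simp: J_def)
    have "smult (a - b) (varY * f i) - comb (Suc i) (\<lambda>c. h c - h' c) f \<in> I"
      using diff[OF h h'] unfolding smult_diff_left comb_diff by (simp add: algebra_simps)
    then show ?thesis by (auto simp: J_def)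
  qed
  have killY: "smult (monom 1 (e i)) (varY * f i) \<in> I"
    using mult[OF kill[of i], of varY] by simp
  have J3: "monom 1 (e i) \<in> J"
    unfolding J_def using killY by (auto intro!: exI[of _ "\<lambda>_. 0"])
  obtain e' where e'_le: "e' \<le> e i" and e'_in: "monom 1 e' \<in> J"
    and e'_dvd: "\<And>h. h \<in> J \<Longrightarrow> monom 1 e' dvd h"
    using order_least[OF J1 J2 J3] by metis
  from e'_in obtain h where h: "smult (monom 1 e') (varY * f i) - comb (Suc i) h f \<in> I"
    unfolding J_def by blast
  \<comment> \<open>Raising the exponent from e' to \<open>e i\<close> kills the term with y f_i.
    What remains is a relation among the old generators, and \<open>indep\<close> forces powers of x
    into the \<open>h c\<close>.\<close>
  have "smult (monom 1 (e i - e')) (smult (monom 1 e') (varY * f i) - comb (Suc i) h f) \<in> I"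
    by (rule smult[OF h])
  then have "smult (monom 1 (e i)) (varY * f i) - comb (Suc i) (\<lambda>c. monom 1 (e i - e') * h c) f \<in> I"
    unfolding comb_smult smult_diff_right smult_smult mult_monom using e'_le by simp
  then have "comb (Suc i) (\<lambda>c. monom 1 (e i - e') * h c) f \<in> I"
    using diff[OF killY] by fastforce
  note dvd = indep[OF this]
  have low: "coeff (h c) l = 0" if "c \<le> i" "l < e c - e i + e'" for c l
  proof -
    have "coeff (monom 1 (e i - e') * h c) (l + (e i - e')) = 0"
      using dvd[of c] that anti'[of c] e'_le unfolding monom_1_dvd_iff' by auto
    then show ?thesis by (simp add: coeff_monom_mult)
  qed
  \<comment> \<open>The coefficients of \<open>h c\<close> from x^e' up to, but excluding, x^(e c),
    shifted down by e'. Those from x^(e c) on are dropped, as they annihilate \<open>f c\<close>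
    modulo \<open>I\<close>.\<close>
  define q' where "q' c = poly_cutoff (e c - e') (poly_shift e' (h c))" for c
  have hq: "h c = monom 1 e' * q' c + monom 1 (e c) * poly_shift (e c) (h c)" if "c \<le> i" for c
    unfolding q'_def by (rule monom_split) (use that low[of c] anti'[of c] e'_le in auto)
  have deg': "e c - e i \<le> m \<and> m < e c - e'" if "c \<le> i" "coeff (q' c) m \<noteq> 0" for c m
  proof -
    have "m < e c - e'" "coeff (h c) (m + e') \<noteq> 0" using that
      by (auto simp: q'_def coeff_poly_cutoff coeff_poly_shift split: if_splits)
    then show ?thesis using low[of c "m + e'"] that(1) by (meson add_less_mono1 not_le)
  qed
  define g where "g = varY * f i - comb (Suc i) q' f"
  have "comb (Suc i) h f = comb (Suc i) (\<lambda>c. monom 1 e' * q' c + monom 1 (e c) * poly_shift (e c) (h c)) f"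
    by (rule comb_cong) (use hq in auto)
  also have "\<dots> = smult (monom 1 e') (comb (Suc i) q' f)
      + comb (Suc i) (\<lambda>c. monom 1 (e c) * poly_shift (e c) (h c)) f"
    by (simp only: comb_add comb_smult)
  finally have h_eq: "comb (Suc i) h f = smult (monom 1 e') (comb (Suc i) q' f)
      + comb (Suc i) (\<lambda>c. monom 1 (e c) * poly_shift (e c) (h c)) f" .
  have "comb (Suc i) (\<lambda>c. monom 1 (e c) * poly_shift (e c) (h c)) f \<in> I"
    by (rule comb, rule smult_dvd[OF kill]) auto
  from add[OF h this] have killg: "smult (monom 1 e') g \<in> I"
    unfolding h_eq g_def smult_diff_right by (simp add: algebra_simps)
  define F where "F = f(Suc i := g)"
  define E where "E = e(Suc i := e')"
  define Q where "Q = q(i := q')"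
  have combF: "comb (Suc j) h F = comb (Suc j) h f" if "j \<le> i" for j h
    by (rule comb_cong) (use that in \<open>auto simp: F_def\<close>)
  have "monom 1 (E c) dvd h c" if H: "comb (Suc (Suc i)) h F \<in> I" and c: "c \<le> Suc i" for h c
  proof -
    have eq: "comb (Suc (Suc i)) h F = comb (Suc i) h f + smult (h (Suc i)) g"
      by (simp add: comb_Suc[of "Suc i"] combF) (simp add: F_def)
    also have "\<dots> = smult (h (Suc i)) (varY * f i)
        - comb (Suc i) (\<lambda>c. h (Suc i) * q' c - h c) f"
      by (simp only: comb_diff comb_smult g_def smult_diff_right) simp
    \<comment> \<open>In a relation, the coefficient of the new generator multiplies y f_i into the
      old span, so x^e' divides it. The new term then lies in \<open>I\<close> by itself, and the
      old independence applies to the rest.\<close>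
    finally have "h (Suc i) \<in> J" using H unfolding J_def by auto
    then have d: "monom 1 e' dvd h (Suc i)" by (rule e'_dvd)
    have "smult (h (Suc i)) g \<in> I" using smult_dvd[OF killg d] .
    then have "comb (Suc i) h f \<in> I" using H add_cancel unfolding eq by blast
    from indep[OF this] d c show ?thesis by (auto simp: E_def le_Suc_eq)
  qed
  moreover have "F (Suc j) = varY * F j - comb (Suc j) (Q j) F" if "j < Suc i" for j
    using that f_Suc[of j] combF[of j]
    by (cases "j = i") (auto simp: F_def Q_def g_def)
  moreover have "E (Suc c) \<le> E c" if "c < Suc i" for c
    using that e_Suc[of c] e'_le by (cases "c = i") (auto simp: E_def)
  moreover have "smult (monom 1 (E c)) (F c) \<in> I" if "c \<le> Suc i" for c
    using that kill[of c] killg by (cases "c = Suc i") (auto simp: E_def F_def)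
  moreover have "E c - E j \<le> m \<and> m < E c - E (Suc j)"
    if "j < Suc i" "c \<le> j" "coeff (Q j c) m \<noteq> 0" for j c m
    using that supp[of j c m] deg'[of c m] by (cases "j = i") (auto simp: E_def Q_def)
  ultimately have "stair_basis I K (Suc i) F E Q"
    using f_0 by unfold_locales (auto simp: F_def)
  then show ?thesis by blast
qed

end

context nil_ideal
begin

text \<open>The cyclic module generated by 1, with \<open>e\<close> the order of 1. Only the values
  at 0 matter at this stage, so constant functions serve.\<close>

lemma stair_basis_0: "\<exists>e. stair_basis I K 0 (\<lambda>_. 1) e (\<lambda>_ _. 0)"
proof -
  define J where "J = {g. [:g:] \<in> I}"
  have 1: "q * p \<in> J" if "p \<in> J" for p q using that mult[of "[:p:]" "[:q:]"] by (simp add: J_def mult.commute)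
  have 2: "p - q \<in> J" if "p \<in> J" "q \<in> J" for p q using that diff[of "[:p:]" "[:q:]"] by (simp add: J_def)
  have "monom 1 K \<in> J" using monX by (simp add: J_def)
  from order_least[OF 1 2 this] obtain e
    where "monom 1 e \<in> J" "\<And>h. h \<in> J \<Longrightarrow> monom 1 e dvd h" by metis
  then have "stair_basis I K 0 (\<lambda>_. 1) (\<lambda>_. e) (\<lambda>_ _. 0)"
    using \<open>monom 1 e \<in> J\<close>
    by unfold_locales (auto simp: comb_Suc J_def one_pCons, auto simp: comb_def)
  then show ?thesis by blast
qed

lemma stair_basis_exists: "\<exists>f e q. stair_basis I K i f e q"
proof (induction i)
  case 0
  show ?case using stair_basis_0 by blast
next
  case (Suc i)
  then show ?case using stair_basis.extend by blast
qed

end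

section \<open>Spanning by the generators modulo the ideal\<close>

context stair_basis
begin

definition spanned :: "nat \<Rightarrow> 'a poly poly \<Rightarrow> bool" where
  "spanned d p \<longleftrightarrow> (\<exists>h. p - comb d h f \<in> I)"

lemma spannedI: "p - comb d h f \<in> I \<Longrightarrow> spanned d p"
  by (auto simp: spanned_def)

lemma spanned_ideal: "p \<in> I \<Longrightarrow> spanned d p"
  by (rule spannedI[of _ _ "\<lambda>_. 0"]) simp

lemma spanned_comb: "spanned d (comb d h f)"
  by (rule spannedI[of _ _ h]) (simp add: zero)

lemma spanned_f: "c < d \<Longrightarrow> spanned d (f c)"
  by (rule spannedI[of _ _ "\<lambda>c'. if c' = c then 1 else 0"]) (simp add: comb_single zero)

lemma spanned_add:
  assumes "spanned d p" "spanned d p'"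
  shows "spanned d (p + p')"
proof -
  obtain h where h: "p - comb d h f \<in> I" using assms(1) by (auto simp: spanned_def)
  obtain h' where h': "p' - comb d h' f \<in> I" using assms(2) by (auto simp: spanned_def)
  show ?thesis
    by (rule spannedI[of _ _ "\<lambda>c. h c + h' c"])
      (use add[OF h h'] in \<open>simp add: comb_add algebra_simps\<close>)
qed

lemma spanned_smult:
  assumes "spanned d p"
  shows "spanned d (smult a p)"
proof -
  obtain h where h: "p - comb d h f \<in> I" using assms by (auto simp: spanned_def)
  show ?thesis
    by (rule spannedI[of _ _ "\<lambda>c. a * h c"])
      (use smult[OF h, of a] in \<open>simp add: comb_smult smult_diff_right\<close>)
qed

lemma spanned_Suc:
  assumes "spanned d p"
  shows "spanned (Suc d) p"
proof -
  obtain h where h: "p - comb d h f \<in> I" using assms by (auto simp: spanned_def)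
  have "comb (Suc d) (h(d := 0)) f = comb d h f"
    by (simp add: comb_Suc) (rule comb_cong, auto)
  then show ?thesis using h by (intro spannedI[of _ _ "h(d := 0)"]) simp
qed

lemma spanned_mono: "spanned d p \<Longrightarrow> d \<le> d' \<Longrightarrow> spanned d' p"
  by (rotate_tac 1, induction rule: dec_induct) (auto intro: spanned_Suc)

lemma varY_f:
  assumes "c < i"
  shows "varY * f c = f (Suc c) + comb (Suc c) (q c) f"
  using f_Suc[OF assms] by simp

lemma spanned_varY_f:
  assumes "c < i" "c < d"
  shows "spanned (Suc d) (varY * f c)"
  unfolding varY_f[OF assms(1)]
  by (intro spanned_add spanned_f spanned_mono[OF spanned_comb]) (use assms in auto)

text \<open>Multiplication by y is linear over F[x], so it suffices to know where the generators
  go.\<close>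

lemma spanned_varY:
  assumes p: "spanned d p" and D: "\<And>c. c < d \<Longrightarrow> spanned D (varY * f c)"
  shows "spanned D (varY * p)"
proof -
  obtain h where h: "p - comb d h f \<in> I" using p by (auto simp: spanned_def)
  have "spanned D (varY * comb d' h f)" if "d' \<le> d" for d'
    using that
  proof (induction d')
    case 0
    show ?case using spanned_ideal[OF zero] by (simp add: comb_def)
  next
    case (Suc d')
    have "varY * comb (Suc d') h f = varY * comb d' h f + smult (h d') (varY * f d')"
      by (simp add: comb_Suc algebra_simps)
    then show ?case using Suc spanned_add spanned_smult D by simp
  qed
  then have "spanned D (varY * comb d h f)" by simp
  moreover have "spanned D (varY * (p - comb d h f))" by (rule spanned_ideal, rule mult, rule h)
  ultimately have "spanned D (varY * (p - comb d h f) + varY * comb d h f)" by (intro spanned_add)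
  then show ?thesis by (simp add: algebra_simps)
qed

lemma monom_Suc': "monom 1 (Suc d) = varY * (monom 1 d :: 'a poly poly)"
  by (simp add: varY_def monom_Suc)

text \<open>The monicity of \<open>f d\<close>, in the form that allows a power of y to be traded
  for a generator.\<close>

lemma spanned_monom_diff: "d \<le> i \<Longrightarrow> spanned d (monom 1 d - f d)"
proof (induction d)
  case 0
  then show ?case using spanned_ideal[OF zero] by (simp add: f_0)
next
  case (Suc d)
  have "monom 1 (Suc d) - f (Suc d) = varY * (monom 1 d - f d) + comb (Suc d) (q d) f"
    unfolding monom_Suc' using varY_f[of d] Suc.prems by (simp add: algebra_simps)
  moreover have "spanned (Suc d) (varY * (monom 1 d - f d))"
    by (rule spanned_varY[of d]) (use Suc in \<open>auto intro: spanned_varY_f\<close>)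
  ultimately show ?case using spanned_add spanned_comb by simp
qed

text \<open>y^K lies in the ideal and equals \<open>f K\<close> plus a combination of earlier
  generators. This is a relation with coefficient 1 at \<open>f K\<close>, so x^(e K) divides 1, and
  the construction may stop at stage \<open>K\<close>.\<close>

lemma e_K:
  assumes "K \<le> i"
  shows "e K = 0"
proof -
  obtain h where h: "monom 1 K - f K - comb K h f \<in> I"
    using spanned_monom_diff[OF assms] by (auto simp: spanned_def)
  \<comment> \<open>\<open>indep\<close> speaks of relations of length \<open>Suc i\<close>, hence
    the padding with zeros beyond \<open>K\<close>.\<close>
  define h' where "h' c = (if c < K then h c else if c = K then 1 else 0)" for c
  have "comb d h' f = comb (Suc K) h' f" if "Suc K \<le> d" for d
    using that
  proof (induction rule: dec_induct)
    case (step d)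
    then show ?case by (simp add: comb_Suc[of d] h'_def)
  qed simp
  from this[of "Suc i"] have "comb (Suc i) h' f = comb (Suc K) h' f" using assms by blast
  also have "\<dots> = comb K h' f + f K" by (simp add: comb_Suc h'_def)
  also have "comb K h' f = comb K h f" by (rule comb_cong) (auto simp: h'_def)
  finally have "comb (Suc i) h' f \<in> I" using diff[OF monY h] by (simp add: algebra_simps)
  then have "monom 1 (e K) dvd h' K" using assms by (intro indep) auto
  then show ?thesis unfolding monom_1_dvd_iff' h'_def by auto
qed

end

section \<open>A complete system of generators\<close>

locale full_stair_basis = stair_basis +
  assumes e_i: "e i = 0"
begin

lemma f_mem: "c \<le> i \<Longrightarrow> e c = 0 \<Longrightarrow> f c \<in> I"
  using kill[of c] by (simp add: monom_0 flip: one_pCons)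

text \<open>The span contains 1 and is closed under y: the recursion handles the earlier generators,
  and the last one has exponent 0, hence lies in \<open>I\<close>.\<close>

lemma spanned_all: "spanned (Suc i) p"
proof (induction p)
  case 0
  show ?case by (rule spanned_ideal, rule zero)
next
  case (pCons a p)
  have "spanned (Suc i) (varY * f c)" if "c < Suc i" for c
  proof (cases "c = i")
    case True
    then show ?thesis using spanned_ideal mult f_mem e_i by blast
  next
    case False
    then show ?thesis
      using that by (intro spanned_mono[OF spanned_varY_f[of c "Suc c"]]) auto
  qed
  then have "spanned (Suc i) (varY * p)" by (rule spanned_varY[OF pCons.IH])
  moreover have "spanned (Suc i) (smult a (f 0))" by (intro spanned_smult spanned_f) simp
  ultimately have "spanned (Suc i) (smult a (f 0) + varY * p)" by (rule spanned_add[rotated])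
  then show ?case by (simp add: f_0 varY_def)
qed

text \<open>
  If some \<open>q j c\<close> had a constant term, then modulo \<open>x^(e (j + 1) + 1)\<close> a polynomial in \<open>y\<close> with a nonzero
  coefficient in degree at most \<open>j\<close> would kill \<open>x^(e (j + 1))\<close>, hence so would \<open>y^j\<close>, as \<open>y\<close> is nilpotent.
  This contradicts the independence of the generators.
\<close>
lemma coeff_q_0: "j < i \<Longrightarrow> c \<le> j \<Longrightarrow> coeff (q j c) 0 = 0"
proof (induction j arbitrary: c rule: less_induct)
  case (less j c0)
  let ?x = "monom 1 1 :: 'a poly"
  have split: "\<exists>u. a = [:coeff a 0:] + ?x * u" for a :: "'a poly"
    by (cases a) (auto simp: monom_altdef)
  \<comment> \<open>By the induction hypothesis the earlier corrections are divisible by x; modulo x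
    the recursion is just multiplication by y.\<close>
  have fx: "\<exists>u. f c = monom 1 c + smult ?x u" if "c \<le> j" for c
    using that
  proof (induction c)
    case 0
    show ?case by (rule exI[of _ 0]) (simp add: f_0)
  next
    case (Suc c)
    then obtain u where u: "f c = monom 1 c + smult ?x u" by auto
    have "coeff (q c d) 0 = 0" if "d \<le> c" for d
      using less.IH[of c d] that Suc.prems less.prems by simp
    then have "\<forall>d. \<exists>s. d \<le> c \<longrightarrow> q c d = ?x * s" using split by (metis add_0 pCons_0_0)
    then obtain s where s: "\<And>d. d \<le> c \<Longrightarrow> q c d = ?x * s d" by metis
    have "comb (Suc c) (q c) f = smult ?x (comb (Suc c) s f)"
      unfolding comb_smult[symmetric] by (rule comb_cong) (use s in auto)
    then have "f (Suc c) = monom 1 (Suc c) + smult ?x (varY * u - comb (Suc c) s f)"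
      using f_Suc[of c] Suc.prems less.prems unfolding monom_Suc' u
      by (simp add: algebra_simps smult_diff_right smult_add_right)
    then show ?case by blast
  qed
  show ?case
  proof (cases "e (Suc j) = e j")
    case True
    \<comment> \<open>Without a drop of the exponent, \<open>supp\<close> leaves an empty
      range.\<close>
    then show ?thesis using supp[OF less.prems, of 0] by linarith
  next
    case False
    then have e_less: "e (Suc j) < e j" using e_Suc[of j] less.prems by simp
    define a where "a = (monom 1 (e (Suc j)) :: 'a poly)"
    \<comment> \<open>The ideal of all \<open>p\<close> such that x^(e (j + 1)) p lies in
      \<open>I\<close> up to a multiple of x^(e (j + 1) + 1); only \<open>p\<close> modulo x
      matters.\<close>
    define J where "J = {p. \<exists>u. smult a (p + smult ?x u) \<in> I}"
    have J1: "p' * p \<in> J" if "p \<in> J" for p p'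
    proof -
      obtain u where "smult a (p + smult ?x u) \<in> I"
        using \<open>p \<in> J\<close> by (auto simp: J_def)
      from mult[OF this, of p'] have "smult a (p' * p + smult ?x (p' * u)) \<in> I"
        by (simp add: algebra_simps smult_add_right)
      then show ?thesis by (auto simp: J_def)
    qed
    have J2: "p - p' \<in> J" if "p \<in> J" "p' \<in> J" for p p'
    proof -
      obtain u where u: "smult a (p + smult ?x u) \<in> I"
        using \<open>p \<in> J\<close> by (auto simp: J_def)
      obtain u' where u': "smult a (p' + smult ?x u') \<in> I"
        using \<open>p' \<in> J\<close> by (auto simp: J_def)
      have "smult a (p - p' + smult ?x (u - u')) \<in> I"
        using diff[OF u u'] by (simp add: algebra_simps smult_add_right smult_diff_right)
      then show ?thesis by (auto simp: J_def)
    qed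
    have J3: "monom 1 K \<in> J"
      unfolding J_def using smult[OF monY] by (auto intro!: exI[of _ 0])
    define s where "s = (LEAST s. monom 1 s \<in> J)"
    have s_in: "monom 1 s \<in> J" unfolding s_def by (rule LeastI, rule J3)
    have s_least: "\<And>m. m < s \<Longrightarrow> monom 1 m \<notin> J" unfolding s_def by (rule not_less_Least)
    \<comment> \<open>If s \<le> j, replace y^s by \<open>f s\<close> and expand the multiple of x
      in the generators. In the resulting relation the coefficient at \<open>f s\<close> contains
      x^(e (j + 1)) with factor 1, yet it is divisible by x^(e s), and e (j + 1) < e s.\<close>
    have "j < s"
    proof (rule ccontr)
      assume "\<not> j < s"
      then have sj: "s \<le> j" by simp
      obtain u where u: "smult a (monom 1 s + smult ?x u) \<in> I"
        using s_in by (auto simp: J_def)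
      obtain u' where u': "f s = monom 1 s + smult ?x u'" using fx[OF sj] by auto
      obtain h where h: "(u - u') - comb (Suc i) h f \<in> I"
        using spanned_all by (auto simp: spanned_def)
      have "comb (Suc i) (\<lambda>c. a * ?x * h c + (if c = s then a else 0)) f
          = smult (a * ?x) (comb (Suc i) h f) + smult a (f s)"
        unfolding comb_add comb_smult using sj less.prems by (simp add: comb_single)
      also have "\<dots> = smult a (monom 1 s + smult ?x u)
          - smult (a * ?x) ((u - u') - comb (Suc i) h f)"
        by (simp add: u' smult_diff_right smult_add_right algebra_simps)
      also have "\<dots> \<in> I" by (intro diff u smult h)
      finally have "monom 1 (e s) dvd a * ?x * h s + (if s = s then a else 0)"
        using sj less.prems by (intro indep) auto
      moreover have "e (Suc j) < e s" using e_less e_antimono[of s j] sj less.prems by simp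
      ultimately have "coeff (a * ?x * h s + a) (e (Suc j)) = 0"
        by (simp add: monom_1_dvd_iff')
      then show False
        unfolding a_def mult_monom by (simp add: coeff_monom_mult)
    qed
    define b where "b c = coeff (q j c) 0" for c
    \<comment> \<open>This is \<open>f (Suc j)\<close> modulo x, so \<open>kill\<close> puts it into
      \<open>J\<close>. Its coefficients in degrees up to j are the negated constant terms in
      question.\<close>
    define h where "h = monom 1 (Suc j) - (\<Sum>c<Suc j. monom [:b c:] c)"
    have "\<forall>c. \<exists>u. q j c = [:b c:] + ?x * u" using split[of "q j _"] unfolding b_def by blast
    then obtain r where r: "\<And>c. q j c = [:b c:] + ?x * r c" by metis
    obtain v where v: "\<And>c. c \<le> j \<Longrightarrow> f c = monom 1 c + smult ?x (v c)" using fx by metis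
    have "comb (Suc j) (q j) f
        = comb (Suc j) (\<lambda>c. [:b c:]) (\<lambda>c. monom 1 c + smult ?x (v c))
          + smult ?x (comb (Suc j) r f)"
      unfolding comb_smult[symmetric] comb_add[symmetric] r
      unfolding comb_add by (rule arg_cong2[where f = "(+)"], rule comb_cong) (use v in auto)
    also have "comb (Suc j) (\<lambda>c. [:b c:]) (\<lambda>c. monom 1 c + smult ?x (v c))
        = (\<Sum>c<Suc j. monom [:b c:] c) + smult ?x (comb (Suc j) (\<lambda>c. [:b c:]) v)"
      unfolding comb_def
      by (simp add: smult_add_right sum.distrib smult_sum2 smult_monom mult.commute)
    finally have comb_q: "comb (Suc j) (q j) f = (\<Sum>c<Suc j. monom [:b c:] c)
      + smult ?x (comb (Suc j) (\<lambda>c. [:b c:]) v) + smult ?x (comb (Suc j) r f)" .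
    have "f (Suc j) = h + smult ?x
        (varY * v j - comb (Suc j) (\<lambda>c. [:b c:]) v - comb (Suc j) r f)"
      using f_Suc[of j] v[of j] less.prems unfolding comb_q h_def monom_Suc'
      by (simp add: algebra_simps smult_diff_right smult_add_right)
    then have h_in: "h \<in> J" using kill[of "Suc j"] less.prems unfolding J_def a_def by force
    have coeff_h: "coeff h c = - [:b c:]" if "c \<le> j" for c
      using that unfolding h_def by (simp add: coeff_sum if_distrib cong: if_cong)
    \<comment> \<open>The lemma on lowest coefficients is applied over F[x]: a constant that is not
      a unit there is zero, and j < s covers all the degrees concerned.\<close>
    have "b c = 0" if "c \<le> j" for c
      using that
    proof (induction c rule: less_induct)
      case (less c)
      have "\<not> coeff h c dvd 1"
        by (rule lowest_coeff_not_unit[OF J1 J2 s_in s_least h_in])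
          (use less \<open>j < s\<close> coeff_h in auto)
      then show ?case using less.prems coeff_h by (auto simp: const_poly_dvd_const_poly_iff one_pCons dvd_field_iff)
    qed
    then show ?thesis using less.prems by (simp add: b_def)
  qed
qed

end

lemma (in nil_ideal) full_stair_basis_exists: "\<exists>f e q. full_stair_basis I K K f e q"
  using stair_basis_exists[of K] stair_basis.e_K
  by (metis full_stair_basis.intro full_stair_basis_axioms.intro order_refl)

section \<open>Evaluation at a pair of commuting nilpotent matrices\<close>

lemma pow_mat_comm:
  assumes "A \<in> carrier_mat n n" "B \<in> carrier_mat n n" "A * B = B * A"
  shows "A * B ^\<^sub>m k = B ^\<^sub>m k * (A :: 'a :: semiring_1 mat)"
proof (induction k)
  case (Suc k)
  have "A * B ^\<^sub>m Suc k = (A * B ^\<^sub>m k) * B"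
    using assms by (simp add: assoc_mult_mat[of A n n _ n B n])
  also have "\<dots> = B ^\<^sub>m k * (A * B)"
    unfolding Suc using assms by (simp add: assoc_mult_mat[of _ n n A n B n])
  also have "\<dots> = B ^\<^sub>m Suc k * A"
    unfolding assms(3) using assms by (simp add: assoc_mult_mat[of _ n n B n A n])
  finally show ?case .
qed (use assms in auto)

text \<open>Zero rows pad \<open>A\<close> to a square matrix, whose transpose kills the unit vector
  belonging to the first added row; so the determinant is 0.\<close>

lemma exists_kernel_vector:
  fixes A :: "'a :: field mat"
  assumes A: "A \<in> carrier_mat h n" and "h < n"
  shows "\<exists>v \<in> carrier_vec n. v \<noteq> 0\<^sub>v n \<and> A *\<^sub>v v = 0\<^sub>v h"
proof -
  define B where "B = mat n n (\<lambda>(i, j). if i < h then A $$ (i, j) else 0)"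
  have B: "B \<in> carrier_mat n n" by (simp add: B_def)
  have "B\<^sup>T *\<^sub>v unit_vec n h = 0\<^sub>v n"
    using \<open>h < n\<close> by (intro eq_vecI) (auto simp: B_def scalar_prod_def unit_vec_def if_distrib cong: if_cong)
  moreover have "unit_vec n h \<noteq> (0\<^sub>v n :: 'a vec)" using \<open>h < n\<close> by simp
  ultimately have "det B\<^sup>T = 0"
    using B by (subst det_0_iff_vec_prod_zero_field[of _ n]) (auto intro!: exI[of _ "unit_vec n h"])
  then have "det B = 0" using det_transpose[OF B] by simp
  then obtain v where v: "v \<in> carrier_vec n" "v \<noteq> 0\<^sub>v n" "B *\<^sub>v v = 0\<^sub>v n"
    using det_0_iff_vec_prod_zero_field[OF B] by auto
  have "A *\<^sub>v v = 0\<^sub>v h"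
  proof (rule eq_vecI)
    fix i assume i: "i < dim_vec (0\<^sub>v h :: 'a vec)"
    have "(A *\<^sub>v v) $ i = (B *\<^sub>v v) $ i"
      using i A v(1) \<open>h < n\<close> by (simp add: B_def scalar_prod_def)
    then show "(A *\<^sub>v v) $ i = 0\<^sub>v h $ i" using i v(3) \<open>h < n\<close> by simp
  qed (use A in simp)
  then show ?thesis using v by blast
qed

text \<open>Trivial kernels on both sides exclude h < n and n < h. Squareness is a conclusion here,
  so that the number of generators of a basis need not be counted in advance.\<close>

lemma invertible_of_trivial_kernels:
  fixes A :: "'a :: field mat"
  assumes A: "A \<in> carrier_mat h n"
    and inj: "\<And>v. v \<in> carrier_vec n \<Longrightarrow> A *\<^sub>v v = 0\<^sub>v h \<Longrightarrow> v = 0\<^sub>v n"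
    and surj: "\<And>v. v \<in> carrier_vec h \<Longrightarrow> A\<^sup>T *\<^sub>v v = 0\<^sub>v n \<Longrightarrow> v = 0\<^sub>v h"
  shows "h = n \<and> (\<exists>A'. A' \<in> carrier_mat n n \<and> A * A' = 1\<^sub>m n \<and> A' * A = 1\<^sub>m n)"
proof -
  have "h = n"
    using exists_kernel_vector[OF A] exists_kernel_vector[of "A\<^sup>T" n h] A inj surj
    by (metis linorder_neqE_nat transpose_carrier_mat)
  with A have A': "A \<in> carrier_mat n n" by simp
  have "det A \<noteq> 0"
    using inj \<open>h = n\<close> by (subst det_0_iff_vec_prod_zero_field[OF A']) auto
  then have "A \<in> Units (ring_mat TYPE('a) n ())" by (rule det_non_zero_imp_unit[OF A'])
  then show ?thesis using \<open>h = n\<close> unfolding Units_def ring_mat_def by auto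
qed

locale nilpotent_pair =
  fixes M N :: "'a :: field mat" and n K :: nat
  assumes M: "M \<in> carrier_mat n n" and N: "N \<in> carrier_mat n n"
    and comm: "M * N = N * M"
    and K: "0 < K"
    and M_K: "M ^\<^sub>m K = 0\<^sub>m n n" and N_K: "N ^\<^sub>m K = 0\<^sub>m n n"
begin

text \<open>The sums may stop at \<open>K\<close>, for every \<open>p\<close>, because all higher powers of \<open>M\<close> and \<open>N\<close> vanish.\<close>
definition ev :: "'a poly poly \<Rightarrow> 'a mat" where
  "ev p = mat n n (\<lambda>(a, b). \<Sum>i<K. \<Sum>j<K. coeff (coeff p i) j * (M ^\<^sub>m j * N ^\<^sub>m i) $$ (a, b))"

lemma ev_carrier [simp]: "ev p \<in> carrier_mat n n"
  by (simp add: ev_def)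

lemma ev_dim [simp]: "dim_row (ev p) = n" "dim_col (ev p) = n"
  by (simp_all add: ev_def)

lemma ev_index:
  "a < n \<Longrightarrow> b < n \<Longrightarrow>
    ev p $$ (a, b) = (\<Sum>i<K. \<Sum>j<K. coeff (coeff p i) j * (M ^\<^sub>m j * N ^\<^sub>m i) $$ (a, b))"
  by (simp add: ev_def)

lemma ev_add: "ev (p + q) = ev p + ev q"
  by (rule eq_matI) (auto simp: ev_index sum.distrib algebra_simps)

lemma ev_0: "ev 0 = 0\<^sub>m n n"
  by (rule eq_matI) (auto simp: ev_index)

lemma ev_const: "ev (smult [:c:] p) = c \<cdot>\<^sub>m ev p"
  by (rule eq_matI) (auto simp: ev_index sum_distrib_left algebra_simps)

text \<open>Multiplication by a variable shifts coefficients. The coefficient pushed beyond the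
  cut-off belongs to \<open>A K\<close>, which is a vanishing power in the applications.\<close>

lemma sum_shift:
  fixes A :: "nat \<Rightarrow> 'b :: comm_semiring_0"
  assumes "A K = 0"
  shows "(\<Sum>j<K. coeff (pCons 0 h) j * A j) = (\<Sum>j<K. coeff h j * A (Suc j))"
proof -
  obtain K' where K': "K = Suc K'" using K by (cases K) auto
  show ?thesis using assms unfolding K'
    by (subst sum.lessThan_Suc_shift, subst sum.lessThan_Suc) simp
qed

lemma pow_carrier: "M ^\<^sub>m j * N ^\<^sub>m i \<in> carrier_mat n n"
  using M N by (intro mult_carrier_mat[of _ n n] pow_carrier_mat)

lemma ev_one: "ev 1 = 1\<^sub>m n"
proof (rule eq_matI)
  fix a b assume ab: "a < dim_row (1\<^sub>m n :: 'a mat)" "b < dim_col (1\<^sub>m n :: 'a mat)"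
  have "ev 1 $$ (a, b) =
      (\<Sum>i<K. if i = 0 then \<Sum>j<K. if j = 0 then (M ^\<^sub>m j * N ^\<^sub>m i) $$ (a, b) else 0 else 0)"
    using ab by (simp only: ev_index index_one_mat, intro sum.cong[OF refl])
      (auto simp: coeff_1 intro!: sum.cong)
  also have "\<dots> = (M ^\<^sub>m 0 * N ^\<^sub>m 0) $$ (a, b)" using K by simp
  finally show "ev 1 $$ (a, b) = 1\<^sub>m n $$ (a, b)"
    using ab carrier_matD[OF M] carrier_matD[OF N] by simp
qed auto

lemma mult_ev_index:
  assumes "A \<in> carrier_mat n n" "a < n" "b < n"
  shows "(A * ev p) $$ (a, b) =
    (\<Sum>i<K. \<Sum>j<K. coeff (coeff p i) j * (A * (M ^\<^sub>m j * N ^\<^sub>m i)) $$ (a, b))"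
proof -
  have "(A * ev p) $$ (a, b) = (\<Sum>l<n. A $$ (a, l) *
      (\<Sum>i<K. \<Sum>j<K. coeff (coeff p i) j * (M ^\<^sub>m j * N ^\<^sub>m i) $$ (l, b)))"
    using assms by (simp add: scalar_prod_def ev_index lessThan_atLeast0)
  also have "\<dots> = (\<Sum>l<n. \<Sum>i<K. \<Sum>j<K. coeff (coeff p i) j * (A $$ (a, l) * (M ^\<^sub>m j * N ^\<^sub>m i) $$ (l, b)))"
    by (simp add: sum_distrib_left algebra_simps)
  also have "\<dots> = (\<Sum>i<K. \<Sum>l<n. \<Sum>j<K. coeff (coeff p i) j * (A $$ (a, l) * (M ^\<^sub>m j * N ^\<^sub>m i) $$ (l, b)))"
    by (rule sum.swap)
  also have "\<dots> = (\<Sum>i<K. \<Sum>j<K. \<Sum>l<n. coeff (coeff p i) j * (A $$ (a, l) * (M ^\<^sub>m j * N ^\<^sub>m i) $$ (l, b)))"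
    by (intro sum.cong sum.swap refl)
  also have "\<dots> = (\<Sum>i<K. \<Sum>j<K. coeff (coeff p i) j * (\<Sum>l<n. A $$ (a, l) * (M ^\<^sub>m j * N ^\<^sub>m i) $$ (l, b)))"
    by (simp add: sum_distrib_left)
  also have "\<dots> = (\<Sum>i<K. \<Sum>j<K. coeff (coeff p i) j * (A * (M ^\<^sub>m j * N ^\<^sub>m i)) $$ (a, b))"
  proof (intro sum.cong refl arg_cong2[where f = "(*)"])
    fix i j
    have P: "M ^\<^sub>m j * N ^\<^sub>m i \<in> carrier_mat n n" by (rule pow_carrier)
    show "(\<Sum>l<n. A $$ (a, l) * (M ^\<^sub>m j * N ^\<^sub>m i) $$ (l, b)) = (A * (M ^\<^sub>m j * N ^\<^sub>m i)) $$ (a, b)"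
      using assms carrier_matD[OF P] by (simp add: scalar_prod_def lessThan_atLeast0 del: index_mult_mat(1))
        (simp add: index_mult_mat(1)[of a A b "M ^\<^sub>m j * N ^\<^sub>m i"] scalar_prod_def)
  qed
  finally show ?thesis .
qed

lemma pow_mult: "M * (M ^\<^sub>m j * N ^\<^sub>m i) = M ^\<^sub>m Suc j * N ^\<^sub>m i"
  "N * (M ^\<^sub>m j * N ^\<^sub>m i) = M ^\<^sub>m j * N ^\<^sub>m Suc i"
proof -
  have "M * (M ^\<^sub>m j * N ^\<^sub>m i) = (M * M ^\<^sub>m j) * N ^\<^sub>m i"
    using M N by (simp add: assoc_mult_mat[of M n n _ n _ n])
  also have "M * M ^\<^sub>m j = M ^\<^sub>m Suc j" using pow_mat_comm[OF M M] by simp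
  finally show "M * (M ^\<^sub>m j * N ^\<^sub>m i) = M ^\<^sub>m Suc j * N ^\<^sub>m i" .
  have "N * (M ^\<^sub>m j * N ^\<^sub>m i) = (N * M ^\<^sub>m j) * N ^\<^sub>m i"
    using M N by (simp add: assoc_mult_mat[of N n n _ n _ n])
  also have "N * M ^\<^sub>m j = M ^\<^sub>m j * N" using pow_mat_comm[OF N M comm[symmetric]] .
  also have "M ^\<^sub>m j * N * N ^\<^sub>m i = M ^\<^sub>m j * (N * N ^\<^sub>m i)"
    using M N by (simp add: assoc_mult_mat[of _ n n N n _ n])
  also have "N * N ^\<^sub>m i = N ^\<^sub>m Suc i" using pow_mat_comm[OF N N] by simp
  finally show "N * (M ^\<^sub>m j * N ^\<^sub>m i) = M ^\<^sub>m j * N ^\<^sub>m Suc i" .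
qed

lemma pow_K: "M ^\<^sub>m K * N ^\<^sub>m i = 0\<^sub>m n n" "M ^\<^sub>m j * N ^\<^sub>m K = 0\<^sub>m n n"
  using M N by (simp_all add: M_K N_K)

lemma ev_X: "ev (smult (monom 1 1) p) = M * ev p"
proof (rule eq_matI)
  fix a b assume "a < dim_row (M * ev p)" "b < dim_col (M * ev p)"
  then have ab: "a < n" "b < n" using M by auto
  show "ev (smult (monom 1 1) p) $$ (a, b) = (M * ev p) $$ (a, b)"
    unfolding mult_ev_index[OF M ab] ev_index[OF ab] pow_mult
  proof (rule sum.cong[OF refl])
    fix i
    have "coeff (smult (monom 1 1) p) i = pCons 0 (coeff p i)" by (simp add: monom_altdef)
    then show "(\<Sum>j<K. coeff (coeff (smult (monom 1 1) p) i) j * (M ^\<^sub>m j * N ^\<^sub>m i) $$ (a, b)) =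
      (\<Sum>j<K. coeff (coeff p i) j * (M ^\<^sub>m Suc j * N ^\<^sub>m i) $$ (a, b))"
      using sum_shift[of "\<lambda>j. (M ^\<^sub>m j * N ^\<^sub>m i) $$ (a, b)"] ab pow_K(1) by simp
  qed
qed (use M in auto)

lemma ev_Y: "ev (varY * p) = N * ev p"
proof (rule eq_matI)
  fix a b assume "a < dim_row (N * ev p)" "b < dim_col (N * ev p)"
  then have ab: "a < n" "b < n" using N by auto
  obtain K' where K': "K = Suc K'" using K by (cases K) auto
  define F where "F h i = (\<Sum>j<K. coeff h j * (M ^\<^sub>m j * N ^\<^sub>m i) $$ (a, b))" for h i
  have F0: "F 0 i = 0" "F h K = 0" for i h
    using ab by (simp_all add: F_def pow_K(2))
  have "varY * p = pCons 0 p" by (simp add: varY_def)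
  then have "ev (varY * p) $$ (a, b) = (\<Sum>i<K. F (coeff (pCons 0 p) i) i)"
    using ab by (simp add: ev_index F_def)
  also have "\<dots> = (\<Sum>i<K. F (coeff p i) (Suc i))"
    using F0 unfolding K' by (subst sum.lessThan_Suc_shift, subst sum.lessThan_Suc) simp
  also have "\<dots> = (N * ev p) $$ (a, b)"
    unfolding mult_ev_index[OF N ab] pow_mult F_def ..
  finally show "ev (varY * p) $$ (a, b) = (N * ev p) $$ (a, b)" .
qed (use N in auto)

lemma ev_smult: "ev (smult h q) = ev [:h:] * ev q"
proof (induction h)
  case 0
  show ?case using ev_0 by simp
next
  case (pCons c h)
  have split: "smult (pCons c h) q = smult [:c:] q + smult (monom 1 1) (smult h q)" for q :: "'a poly poly"
    by (simp add: monom_altdef smult_add_left[symmetric])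
  have "[:pCons c h:] = smult [:c:] 1 + smult (monom 1 1) [:h:]"
    using split[of 1] by (simp add: one_pCons)
  then have "ev [:pCons c h:] = c \<cdot>\<^sub>m 1\<^sub>m n + M * ev [:h:]"
    by (simp only: ev_add ev_const ev_X ev_one)
  then have "ev [:pCons c h:] * ev q = c \<cdot>\<^sub>m ev q + M * ev [:h:] * ev q"
    using M by (simp add: add_mult_distrib_mat[of _ n n _ _ n] mult_smult_assoc_mat[of _ n n _ n])
  moreover have "M * ev [:h:] * ev q = M * (ev [:h:] * ev q)"
    using M by (simp add: assoc_mult_mat[of M n n _ n _ n])
  ultimately show ?case unfolding split ev_add ev_const ev_X pCons.IH by simp
qed

text \<open>Horner's rule in y, on top of Horner's rule in x in \<open>ev_smult\<close>. So
  evaluation is a ring homomorphism, and all its values commute.\<close>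

lemma ev_mult: "ev (p * q) = ev p * ev q"
proof (induction p)
  case 0
  show ?case using ev_0 by simp
next
  case (pCons h p)
  have "pCons h p * q = smult h q + varY * (p * q)" "pCons h p = [:h:] + varY * p"
    by (simp_all add: varY_def)
  moreover have "(ev [:h:] + N * ev p) * ev q = ev [:h:] * ev q + N * ev p * ev q"
    using N by (intro add_mult_distrib_mat) auto
  moreover have "N * ev p * ev q = N * (ev p * ev q)"
    using N by (simp add: assoc_mult_mat[of N n n _ n _ n])
  ultimately show ?case by (simp only: ev_add ev_smult ev_Y pCons.IH)
qed

lemma ev_monom: "ev (monom (monom 1 a) b) = M ^\<^sub>m a * N ^\<^sub>m b"
proof (induction a)
  case 0
  have "ev (monom 1 b) = N ^\<^sub>m b"
  proof (induction b)
    case 0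
    show ?case using ev_one N by simp
  next
    case (Suc b)
    have "(monom 1 (Suc b) :: 'a poly poly) = varY * monom 1 b" by (simp add: varY_def monom_Suc)
    then show ?case using Suc ev_Y pow_mat_comm[OF N N, of b] by simp
  qed
  then show ?case using M N by simp
next
  case (Suc a)
  have "(monom (monom 1 (Suc a)) b :: 'a poly poly) = smult (monom 1 1) (monom (monom 1 a) b)"
    by (simp add: smult_monom mult_monom)
  then show ?case using Suc ev_X pow_mult(1) by simp
qed

lemma ev_commute: "ev p * ev q = ev q * ev p"
  by (metis ev_mult mult.commute)

lemma ev_X_right: "ev (smult (monom 1 1) p) = ev p * M"
  using ev_commute[of p "smult (monom 1 1) 1"] M unfolding ev_X ev_one by simp

lemma ev_Y_right: "ev (varY * p) = ev p * N"
  using ev_commute[of p "varY * 1"] N unfolding ev_Y ev_one by simp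

lemma ev_sum: "finite A \<Longrightarrow> a < n \<Longrightarrow> b < n \<Longrightarrow> ev (\<Sum>x\<in>A. g x) $$ (a, b) = (\<Sum>x\<in>A. ev (g x) $$ (a, b))"
  by (induction A rule: finite_induct) (simp_all add: ev_0 ev_add)

text \<open>The annihilator of the functional w that takes the coordinate \<open>i0\<close>: row
  \<open>i0\<close> of \<open>ev p\<close> is w p(M, N).\<close>

definition row_ideal :: "nat \<Rightarrow> 'a poly poly set" where
  "row_ideal i0 = {p. \<forall>b<n. ev p $$ (i0, b) = 0}"

lemma nil_ideal_row_ideal:
  assumes "i0 < n"
  shows "nil_ideal (row_ideal i0) K"
proof
  show "p + q \<in> row_ideal i0" if "p \<in> row_ideal i0" "q \<in> row_ideal i0" for p q
    using that assms by (simp add: row_ideal_def ev_add)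
  show "q * p \<in> row_ideal i0" if "p \<in> row_ideal i0" for p q
  proof -
    have "(ev p * ev q) $$ (i0, b) = 0" if "b < n" for b
      using \<open>p \<in> row_ideal i0\<close> assms that by (simp add: row_ideal_def scalar_prod_def)
    then show ?thesis by (simp add: row_ideal_def ev_mult ev_commute[of q])
  qed
  show "[:monom 1 K:] \<in> row_ideal i0"
    using ev_monom[of K 0] pow_K(1)[of 0] assms unfolding monom_0 by (simp add: row_ideal_def)
  show "monom 1 K \<in> row_ideal i0"
    using ev_monom[of 0 K] pow_K(2)[of 0] assms unfolding monom_0 by (simp add: row_ideal_def flip: one_pCons)
qed

end

text \<open>\<open>separating\<close> says that the functionals w p(M, N) vanish together only at 0,
  that is, w generates the dual space over F[x, y].\<close>

locale generic_row = nilpotent_pair +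
  fixes i0 :: nat
  assumes i0: "i0 < n"
    and separating: "\<And>v. v \<in> carrier_vec n \<Longrightarrow> (\<And>p. (ev p *\<^sub>v v) $ i0 = 0) \<Longrightarrow> v = 0\<^sub>v n"
begin

abbreviation I where "I \<equiv> row_ideal i0"

definition rows_mat :: "nat \<Rightarrow> (nat \<Rightarrow> 'a poly poly) \<Rightarrow> 'a mat" where
  "rows_mat h P = mat h n (\<lambda>(l, b). ev (P l) $$ (i0, b))"

lemma rows_mat_carrier [simp]: "rows_mat h P \<in> carrier_mat h n"
  by (simp add: rows_mat_def)

text \<open>Row \<open>i0\<close> does not see elements of \<open>I\<close>, so congruences modulo
  \<open>I\<close> become identities between matrices of rows.\<close>

lemma mult_rows_mat:
  assumes A: "A \<in> carrier_mat h' h"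
    and eq: "\<And>l. l < h' \<Longrightarrow> Q l - (\<Sum>t<h. smult [:A $$ (l, t):] (P t)) \<in> I"
  shows "A * rows_mat h P = rows_mat h' Q"
proof (rule eq_matI)
  fix l b assume "l < dim_row (rows_mat h' Q)" "b < dim_col (rows_mat h' Q)"
  then have lb: "l < h'" "b < n" by (simp_all add: rows_mat_def)
  have "(A * rows_mat h P) $$ (l, b) = (\<Sum>t<h. A $$ (l, t) * ev (P t) $$ (i0, b))"
    using A lb by (simp add: rows_mat_def scalar_prod_def lessThan_atLeast0)
  also have "\<dots> = ev (\<Sum>t<h. smult [:A $$ (l, t):] (P t)) $$ (i0, b)"
    using i0 lb by (simp add: ev_sum ev_const)
  also have "\<dots> = ev (Q l) $$ (i0, b)"
  proof -
    let ?R = "\<Sum>t<h. smult [:A $$ (l, t):] (P t)"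
    have "ev (?R + (Q l - ?R)) $$ (i0, b) = ev ?R $$ (i0, b)"
      using eq[OF lb(1)] lb i0 unfolding ev_add by (simp add: row_ideal_def)
    then show ?thesis by simp
  qed
  finally show "(A * rows_mat h P) $$ (l, b) = rows_mat h' Q $$ (l, b)"
    using lb by (simp add: rows_mat_def)
qed (use A in \<open>auto simp: rows_mat_def\<close>)

lemma rows_mat_mult:
  "rows_mat h P * M = rows_mat h (\<lambda>l. smult (monom 1 1) (P l))"
  "rows_mat h P * N = rows_mat h (\<lambda>l. varY * P l)"
proof -
  have *: "rows_mat h P * A = rows_mat h Q" if A: "A \<in> carrier_mat n n" and "\<And>l. ev (Q l) = ev (P l) * A" for A Q
    using i0 A that(2) by (intro eq_matI) (auto simp: rows_mat_def scalar_prod_def)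
  show "rows_mat h P * M = rows_mat h (\<lambda>l. smult (monom 1 1) (P l))"
    by (rule *[OF M]) (rule ev_X_right)
  show "rows_mat h P * N = rows_mat h (\<lambda>l. varY * P l)"
    by (rule *[OF N]) (rule ev_Y_right)
qed

text \<open>If \<open>A\<close> and \<open>B\<close> describe multiplication by x and y on the
  \<open>P l\<close> modulo \<open>I\<close>, the matrix S with rows w P_l(M, N) satisfies A S = S M
  and B S = S N.\<close>

lemma similar_pair_rows_mat:
  assumes S': "S' \<in> carrier_mat n n" and inv: "rows_mat n P * S' = 1\<^sub>m n" "S' * rows_mat n P = 1\<^sub>m n"
    and A: "A \<in> carrier_mat n n" and B: "B \<in> carrier_mat n n"
    and x: "\<And>l. l < n \<Longrightarrow> smult (monom 1 1) (P l) - (\<Sum>t<n. smult [:A $$ (l, t):] (P t)) \<in> I"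
    and y: "\<And>l. l < n \<Longrightarrow> varY * P l - (\<Sum>t<n. smult [:B $$ (l, t):] (P t)) \<in> I"
  shows "similar_pair (M, N) (A, B)"
proof -
  let ?S = "rows_mat n P"
  have *: "similar_mat_wit C C' ?S S'" if C: "C \<in> carrier_mat n n" "C' \<in> carrier_mat n n" and "C * ?S = ?S * C'" for C C'
  proof (rule similar_mat_witI[OF inv])
    have "?S * C' * S' = C * (?S * S')"
      unfolding that(3)[symmetric] using C S' by (intro assoc_mult_mat) auto
    then show "C = ?S * C' * S'" using C inv by simp
  qed (use C S' in auto)
  have "A * ?S = ?S * M" unfolding rows_mat_mult by (rule mult_rows_mat[OF A]) (rule x)
  moreover have "B * ?S = ?S * N" unfolding rows_mat_mult by (rule mult_rows_mat[OF B]) (rule y)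
  ultimately show ?thesis unfolding similar_pair_def using * A B M N by auto
qed

end

locale stair_rows = generic_row M N n K i0 + full_stair_basis "row_ideal i0" K K f e q
  for M N :: "'a :: field mat" and n K i0 f e q
begin

definition basis_elem :: "nat \<times> nat \<Rightarrow> 'a poly poly" where
  "basis_elem = (\<lambda>(m, c). smult (monom 1 m) (f c))"

definition labels :: "(nat \<times> nat) set" where
  "labels = {(m, c). c \<le> K \<and> m < e c}"

lemma basis_elem_mem: "c \<le> K \<Longrightarrow> (m, c) \<notin> labels \<Longrightarrow> basis_elem (m, c) \<in> I"
  unfolding basis_elem_def labels_def by (auto intro: smult_monom_mono[OF kill])

lemma sum_labels:
  "comb (Suc K) (\<lambda>c. \<Sum>m<e c. monom (a (m, c)) m) f = (\<Sum>x\<in>labels. smult [:a x:] (basis_elem x))"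
proof -
  have "comb (Suc K) (\<lambda>c. \<Sum>m<e c. monom (a (m, c)) m) f
      = (\<Sum>c\<le>K. \<Sum>m<e c. smult [:a (m, c):] (basis_elem (m, c)))"
    unfolding comb_def lessThan_Suc_atMost
    by (intro sum.cong refl) (simp add: smult_sum basis_elem_def smult_monom)
  also have "\<dots> = (\<Sum>x\<in>labels. smult [:a x:] (basis_elem x))"
    unfolding labels_def by (simp add: sum.Sigma) (rule sum.reindex_bij_witness[of _ prod.swap prod.swap], auto)
  finally show ?thesis .
qed

text \<open>A vector killed by all rows is killed by every w p(M, N), because the generators span,
  and then \<open>separating\<close> applies. A linear dependence between the rows is a relation
  whose coefficients have degree below \<open>e c\<close>, so independence makes them 0. In
  particular the labels number exactly \<open>n\<close>.\<close>

lemma rows_mat_invertible: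
  assumes bij: "bij_betw idx {..<h} labels"
  shows "h = n \<and> (\<exists>S'. S' \<in> carrier_mat n n \<and> rows_mat n (\<lambda>l. basis_elem (idx l)) * S' = 1\<^sub>m n
    \<and> S' * rows_mat n (\<lambda>l. basis_elem (idx l)) = 1\<^sub>m n)"
proof -
  let ?S = "rows_mat h (\<lambda>l. basis_elem (idx l))"
  have "h = n \<and> (\<exists>S'. S' \<in> carrier_mat n n \<and> ?S * S' = 1\<^sub>m n \<and> S' * ?S = 1\<^sub>m n)"
  proof (rule invertible_of_trivial_kernels)
    fix v assume v: "v \<in> carrier_vec n" and Sv: "?S *\<^sub>v v = 0\<^sub>v h"
    define Z where "Z = {p. (ev p *\<^sub>v v) $ i0 = 0}"
    have Z_add: "p + p' \<in> Z" if "p \<in> Z" "p' \<in> Z" for p p'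
      using that v i0 by (simp add: Z_def ev_add add_scalar_prod_distrib[of _ n])
    have Z_const: "smult [:a:] p \<in> Z" if "p \<in> Z" for p a
      using that v i0 by (simp add: Z_def ev_const)
    have Z_I: "p \<in> Z" if "p \<in> I" for p
      using that v i0 by (simp add: Z_def row_ideal_def scalar_prod_def)
    have Z_elem: "basis_elem (m, c) \<in> Z" if "c \<le> K" for m c
    proof (cases "(m, c) \<in> labels")
      case True
      then obtain l where l: "l < h" "idx l = (m, c)" using bij by (force simp: bij_betw_def)
      have "(?S *\<^sub>v v) $ l = (ev (basis_elem (m, c)) *\<^sub>v v) $ i0"
        using l v i0 by (simp add: rows_mat_def scalar_prod_def)
      then show ?thesis using Sv l by (simp add: Z_def)
    qed (use that basis_elem_mem Z_I in blast)
    have Z_smult: "smult (monom 1 m * h) (f c) \<in> Z" if "c \<le> K" for m h c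
    proof (induction h arbitrary: m)
      case 0
      show ?case using Z_I zero by simp
    next
      case (pCons a h)
      have "monom 1 m * pCons a h = [:a:] * monom 1 m + monom 1 (Suc m) * h"
        by (simp add: monom_Suc)
      then have "smult (monom 1 m * pCons a h) (f c)
          = smult [:a:] (basis_elem (m, c)) + smult (monom 1 (Suc m) * h) (f c)"
        by (simp only: smult_add_left basis_elem_def smult_smult prod.case)
      then show ?case using Z_add Z_const Z_elem[OF that] pCons.IH by simp
    qed
    have Z_comb: "comb d h f \<in> Z" if "d \<le> Suc K" for d h
      using that
    proof (induction d)
      case 0
      show ?case using Z_I zero by (simp add: comb_def)
    next
      case (Suc d)
      then show ?case using Z_add Z_smult[of d 0] by (simp add: comb_Suc)
    qed
    have "p \<in> Z" for p
    proof -
      obtain h where "p - comb (Suc K) h f \<in> I" using spanned_all by (auto simp: spanned_def)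
      from Z_add[OF Z_I[OF this] Z_comb[of "Suc K" h]] show ?thesis by simp
    qed
    then show "v = 0\<^sub>v n" using separating[OF v] by (simp add: Z_def)
  next
    fix v :: "'a vec" assume v: "v \<in> carrier_vec h" and Sv: "?S\<^sup>T *\<^sub>v v = 0\<^sub>v n"
    define a where "a x = v $ (inv_into {..<h} idx x)" for x
    have a_idx: "a (idx l) = v $ l" if "l < h" for l
      using that bij by (simp add: a_def bij_betw_def)
    \<comment> \<open>The scalars at labels with the same \<open>c\<close> are collected into one
      coefficient of \<open>f c\<close>, as \<open>indep\<close> requires.\<close>
    define g where "g c = (\<Sum>m<e c. monom (a (m, c)) m)" for c
    have "comb (Suc K) g f = (\<Sum>x\<in>labels. smult [:a x:] (basis_elem x))"
      unfolding g_def by (rule sum_labels)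
    also have "\<dots> = (\<Sum>l<h. smult [:a (idx l):] (basis_elem (idx l)))"
      by (rule sum.reindex_bij_betw[OF bij, symmetric])
    finally have comb_eq: "comb (Suc K) g f = (\<Sum>l<h. smult [:v $ l:] (basis_elem (idx l)))"
      by (simp add: a_idx)
    have "ev (comb (Suc K) g f) $$ (i0, b) = 0" if "b < n" for b
    proof -
      have "ev (comb (Suc K) g f) $$ (i0, b) = (?S\<^sup>T *\<^sub>v v) $ b"
        using that i0 v unfolding comb_eq
        by (simp add: ev_sum ev_const rows_mat_def scalar_prod_def lessThan_atLeast0 mult.commute)
      then show ?thesis using Sv that by simp
    qed
    then have "comb (Suc K) g f \<in> I" by (simp add: row_ideal_def)
    note dvd = indep[OF this]
    have "a (m, c) = 0" if "c \<le> K" "m < e c" for m c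
      using dvd[OF that(1)] that(2) by (simp add: monom_1_dvd_iff' g_def coeff_sum)
    then have "a x = 0" if "x \<in> labels" for x using that by (auto simp: labels_def)
    then have "v $ l = 0" if "l < h" for l
      using a_idx[OF that] that bij by (metis bij_betwE lessThan_iff)
    then show "v = 0\<^sub>v h" using v by (intro eq_vecI) auto
  qed simp
  then show ?thesis by auto
qed

end

text \<open>The common null space is the kernel of \<open>M\<close> stacked on \<open>N\<close>, and
  row reduction preserves it. The kernel basis read off from the reduced form \<open>C\<close> has
  as many vectors as the dimension, hence a single one.\<close>

lemma common_null_space_line:
  fixes M N :: "'a :: field mat"
  assumes M: "M \<in> carrier_mat n n" and N: "N \<in> carrier_mat n n"
    and dim: "subspace_dim n (common_null_space M N) = 1"
  obtains z where "z \<in> carrier_vec n" "z \<noteq> 0\<^sub>v n"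
    "\<And>v. v \<in> carrier_vec n \<Longrightarrow> M *\<^sub>v v = 0\<^sub>v n \<Longrightarrow> N *\<^sub>v v = 0\<^sub>v n \<Longrightarrow> \<exists>a. v = a \<cdot>\<^sub>v z"
proof -
  define A where "A = M @\<^sub>r N"
  define C where "C = gauss_jordan_single A"
  have A: "A \<in> carrier_mat (n + n) n" unfolding A_def using M N by simp
  note C = gauss_jordan_single[OF A C_def[symmetric]]
  have "mat_kernel A = common_null_space M N"
  proof -
    have "A *\<^sub>v v = 0\<^sub>v (n + n) \<longleftrightarrow> M *\<^sub>v v = 0\<^sub>v n \<and> N *\<^sub>v v = 0\<^sub>v n" if v: "v \<in> carrier_vec n" for v
    proof -
      have "(0\<^sub>v (n + n) :: 'a vec) = 0\<^sub>v n @\<^sub>v 0\<^sub>v n" by auto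
      then show ?thesis unfolding A_def mat_mult_append[OF M N v]
        using append_vec_eq[of "M *\<^sub>v v" n "0\<^sub>v n" "N *\<^sub>v v" "0\<^sub>v n"] M v by simp
    qed
    then show ?thesis using A M N by (auto simp: common_null_space_def mat_kernel_def)
  qed
  moreover have "mat_kernel C = mat_kernel A"
    using C(1) carrier_matD[OF A] carrier_matD[OF C(2)] by (auto simp: mat_kernel_def)
  ultimately have ker: "mat_kernel C = common_null_space M N" by simp
  interpret kernel "n + n" n C by unfold_locales (rule C(2))
  have "Ker.dim = 1" using dim unfolding subspace_dim_def ker .
  then have card: "card (set (find_base_vectors C)) = 1"
    using find_base_vectors(4,6)[OF C(3,2)] by simp
  then obtain z where z: "set (find_base_vectors C) = {z}" by (rule card_1_singletonE)
  have z_in: "z \<in> mat_kernel C" and z0: "z \<noteq> 0\<^sub>v n" and basis: "Ker.basis {z}"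
    using find_base_vectors(1,2,3)[OF C(3,2)] unfolding z by auto
  have z_carrier: "z \<in> carrier_vec n" using z_in C(2) by (auto simp: mat_kernel_def)
  have "\<exists>a. v = a \<cdot>\<^sub>v z" if "v \<in> mat_kernel C" for v
  proof -
    have "v \<in> Ker.span {z}" using that basis by (auto simp: Ker.basis_def)
    then obtain a where "v = Ker.lincomb a ({} \<union> {z})" using z_in by (subst (asm) Ker.finite_span) auto
    also have "\<dots> = a z \<cdot>\<^sub>v z + Ker.lincomb a {}"
      using z_in by (subst Ker.lincomb_insert) auto
    also have "Ker.lincomb a {} = 0\<^sub>v n" by (simp add: Ker.lincomb_def)
    finally show ?thesis using z_carrier by auto
  qed
  moreover have "v \<in> mat_kernel C"
    if "v \<in> carrier_vec n" "M *\<^sub>v v = 0\<^sub>v n" "N *\<^sub>v v = 0\<^sub>v n" for v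
    unfolding ker common_null_space_def using that M N by (auto simp: mat_kernel_def)
  ultimately show ?thesis using that[OF z_carrier z0] by blast
qed

lemma pow_mat_nilpotent_mono:
  assumes A: "(A :: 'a :: semiring_1 mat) \<in> carrier_mat n n" and "A ^\<^sub>m k = 0\<^sub>m n n" "k \<le> l"
  shows "A ^\<^sub>m l = 0\<^sub>m n n"
  using assms(3)
proof (induction rule: dec_induct)
  case (step l)
  then show ?case using A by simp
qed (rule assms(2))

text \<open>A coordinate \<open>i0\<close> that does not vanish on the null line is separating. From
  a nonzero v, apply \<open>M\<close> as often as the result stays nonzero, then \<open>N\<close>
  likewise; this ends at a nonzero point of the null line, whose coordinate \<open>i0\<close> is
  nonzero and is a value w p(M, N) v with p a monomial.\<close>

lemma stair_rows_exists:
  fixes M N :: "'a :: field mat"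
  assumes M: "M \<in> carrier_mat n n" and N: "N \<in> carrier_mat n n" and comm: "M * N = N * M"
    and nil: "nilpotent_mat M" "nilpotent_mat N"
    and dim: "subspace_dim n (common_null_space M N) = 1"
  shows "\<exists>K i0 f e q. stair_rows M N n K i0 f e q"
proof -
  obtain k l where "M ^\<^sub>m k = 0\<^sub>m n n" "N ^\<^sub>m l = 0\<^sub>m n n"
    using nil M N by (auto simp: nilpotent_mat_def)
  then have K: "M ^\<^sub>m (Suc (k + l)) = 0\<^sub>m n n" "N ^\<^sub>m (Suc (k + l)) = 0\<^sub>m n n"
    using pow_mat_nilpotent_mono[OF M, of k "Suc (k + l)"] pow_mat_nilpotent_mono[OF N, of l "Suc (k + l)"] by auto
  \<comment> \<open>One exponent for both matrices; the successor makes it positive.\<close>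
  define K where "K = Suc (k + l)"
  interpret nilpotent_pair M N n K
    by unfold_locales (use M N comm K in \<open>auto simp: K_def\<close>)
  obtain z where z: "z \<in> carrier_vec n" "z \<noteq> 0\<^sub>v n"
    and line: "\<And>v. v \<in> carrier_vec n \<Longrightarrow> M *\<^sub>v v = 0\<^sub>v n \<Longrightarrow> N *\<^sub>v v = 0\<^sub>v n \<Longrightarrow> \<exists>a. v = a \<cdot>\<^sub>v z"
    using common_null_space_line[OF M N dim] by metis
  obtain i0 where i0: "i0 < n" "z $ i0 \<noteq> 0"
    using z by (metis carrier_vecD eq_vecI index_zero_vec)
  have sep: "v = 0\<^sub>v n" if v: "v \<in> carrier_vec n" and H: "\<And>p. (ev p *\<^sub>v v) $ i0 = 0" for v
  proof (rule ccontr)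
    assume "v \<noteq> 0\<^sub>v n"
    have step: "\<exists>j. A ^\<^sub>m j *\<^sub>v u \<noteq> 0\<^sub>v n \<and> A *\<^sub>v (A ^\<^sub>m j *\<^sub>v u) = 0\<^sub>v n"
      if A: "A \<in> carrier_mat n n" "A ^\<^sub>m K = 0\<^sub>m n n" and u: "u \<in> carrier_vec n" "u \<noteq> 0\<^sub>v n" for A and u :: "'a vec"
    proof -
      have 0: "A ^\<^sub>m 0 *\<^sub>v u \<noteq> 0\<^sub>v n" using A u by simp
      have 1: "A ^\<^sub>m K *\<^sub>v u = 0\<^sub>v n" unfolding A(2) using u by (intro eq_vecI) auto
      define j where "j = (LEAST j. A ^\<^sub>m j *\<^sub>v u = 0\<^sub>v n)"
      have j: "A ^\<^sub>m j *\<^sub>v u = 0\<^sub>v n" unfolding j_def by (rule LeastI, rule 1)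
      have least: "A ^\<^sub>m i *\<^sub>v u \<noteq> 0\<^sub>v n" if "i < j" for i using that not_less_Least unfolding j_def by blast
      obtain i where i: "j = Suc i" using j 0 by (cases j) auto
      have "A *\<^sub>v (A ^\<^sub>m i *\<^sub>v u) = (A * A ^\<^sub>m i) *\<^sub>v u"
        using A u by (simp add: assoc_mult_mat_vec[of A n n _ n])
      also have "A * A ^\<^sub>m i = A ^\<^sub>m j" unfolding i using pow_mat_comm[OF A(1) A(1)] by simp
      finally show ?thesis using j least[of i] i by auto
    qed
    obtain a where a: "M ^\<^sub>m a *\<^sub>v v \<noteq> 0\<^sub>v n" "M *\<^sub>v (M ^\<^sub>m a *\<^sub>v v) = 0\<^sub>v n"
      using step[OF M M_K v \<open>v \<noteq> 0\<^sub>v n\<close>] by blast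
    define u where "u = M ^\<^sub>m a *\<^sub>v v"
    have u: "u \<in> carrier_vec n"
      unfolding u_def by (rule mult_mat_vec_carrier[OF pow_carrier_mat[OF M] v])
    obtain b where b: "N ^\<^sub>m b *\<^sub>v u \<noteq> 0\<^sub>v n" "N *\<^sub>v (N ^\<^sub>m b *\<^sub>v u) = 0\<^sub>v n"
      using step[OF N N_K u] a by (auto simp: u_def)
    define w where "w = N ^\<^sub>m b *\<^sub>v u"
    have w: "w \<in> carrier_vec n"
      unfolding w_def by (rule mult_mat_vec_carrier[OF pow_carrier_mat[OF N] u])
    have "M *\<^sub>v w = (M * N ^\<^sub>m b) *\<^sub>v u"
      unfolding w_def using M N u by (simp add: assoc_mult_mat_vec[of M n n _ n])
    also have "\<dots> = N ^\<^sub>m b *\<^sub>v (M *\<^sub>v u)"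
      unfolding pow_mat_comm[OF M N comm] using M N u by (simp add: assoc_mult_mat_vec[of _ n n M n])
    also have "\<dots> = 0\<^sub>v n"
      using a carrier_matD[OF N] by (intro eq_vecI) (auto simp: u_def scalar_prod_def)
    finally have "M *\<^sub>v w = 0\<^sub>v n" .
    then obtain s where s: "w = s \<cdot>\<^sub>v z" using line[OF w] b by (auto simp: w_def)
    have "M ^\<^sub>m a * N ^\<^sub>m b = N ^\<^sub>m b * M ^\<^sub>m a"
      by (rule pow_mat_comm[OF _ N pow_mat_comm[OF N M comm[symmetric], symmetric]]) (use M in simp)
    then have "w = ev (monom (monom 1 a) b) *\<^sub>v v"
      unfolding ev_monom w_def u_def using M N v by (simp add: assoc_mult_mat_vec[of _ n n _ n])
    then have "w $ i0 = 0" using H by simp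
    then have "s = 0" using s i0 z by simp
    then have "w = 0\<^sub>v n" using s z by auto
    then show False using b by (simp add: w_def)
  qed
  interpret nil_ideal "row_ideal i0" K by (rule nil_ideal_row_ideal[OF i0(1)])
  obtain f e q where "full_stair_basis (row_ideal i0) K K f e q"
    using full_stair_basis_exists by blast
  moreover have "generic_row M N n K i0" by unfold_locales (use i0 sep in auto)
  ultimately have "stair_rows M N n K i0 f e q" by (intro stair_rows.intro)
  then show ?thesis by blast
qed

text \<open>The number of blocks of each positive size is an invariant of \<open>A\<close>, size 0
  is excluded by \<open>jordan_nf\<close>, and the decreasing order fixes the permutation.\<close>

lemma jordan_sizes_unique:
  fixes A :: "'a :: field mat"
  assumes 1: "jordan_nf A (map (\<lambda>m. (m, 0)) ms)" and 2: "jordan_nf A (map (\<lambda>m. (m, 0)) ms')"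
    and sorted: "sorted (rev ms)" "sorted (rev ms')"
  shows "ms = ms'"
proof -
  have "count (mset ms) k = count (mset ms') k" for k
  proof (cases "k = 0")
    case True
    then show ?thesis using 1 2 by (auto simp: jordan_nf_def image_image count_eq_zero_iff[THEN iffD2])
  next
    case False
    have *: "count (mset ns) k = length (filter ((=) (k, 0)) (map (\<lambda>m. (m, 0 :: 'a)) ns))" for ns
      by (induction ns) auto
    show ?thesis unfolding * using compute_nr_of_jordan_blocks[OF 1 False, of 0]
        compute_nr_of_jordan_blocks[OF 2 False, of 0] by simp
  qed
  then have "mset (rev ms) = mset (rev ms')" by (simp add: multiset_eq_iff)
  then have "rev ms = rev ms'" using sorted by (metis properties_for_sort)
  then show ?thesis by simp
qed

section \<open>Multiplication by x and y in the labelled basis\<close>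

context stair_rows
begin

lemma comb_minus_labels_mem:
  "comb (Suc K) h f - (\<Sum>x\<in>labels. smult [:coeff (h (snd x)) (fst x):] (basis_elem x)) \<in> I"
proof -
  have cut: "poly_cutoff d p = (\<Sum>m<d. monom (coeff p m) m)" for d and p :: "'a poly"
    by (intro poly_eqI) (simp add: coeff_poly_cutoff coeff_sum)
  have "comb (Suc K) h f = comb (Suc K) (\<lambda>c. poly_cutoff (e c) (h c) + monom 1 (e c) * poly_shift (e c) (h c)) f"
    by (rule comb_cong) (use monom_split[of 0] in auto)
  also have "\<dots> = (\<Sum>x\<in>labels. smult [:coeff (h (snd x)) (fst x):] (basis_elem x))
      + comb (Suc K) (\<lambda>c. monom 1 (e c) * poly_shift (e c) (h c)) f"
    unfolding comb_add cut sum_labels[symmetric] by simp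
  finally have eq: "comb (Suc K) h f - (\<Sum>x\<in>labels. smult [:coeff (h (snd x)) (fst x):] (basis_elem x))
    = comb (Suc K) (\<lambda>c. monom 1 (e c) * poly_shift (e c) (h c)) f" by simp
  show ?thesis unfolding eq by (rule comb, rule smult_dvd[OF kill]) auto
qed

text \<open>Row \<open>c\<close> of the matrix over F[x] by which y acts on the generators: the
  recursion solved for y f_c.\<close>

definition next_coeff :: "nat \<Rightarrow> nat \<Rightarrow> 'a poly" where
  "next_coeff c c' = (if c' = Suc c then 1 else if c' \<le> c then q c c' else 0)"

lemma varY_f_eq:
  assumes "c < K"
  shows "varY * f c = comb (Suc K) (next_coeff c) f"
proof -
  have "comb d (next_coeff c) f = comb (Suc (Suc c)) (next_coeff c) f" if "Suc (Suc c) \<le> d" for d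
    using that
  proof (induction rule: dec_induct)
    case (step d)
    then show ?case by (simp add: comb_Suc[of d] next_coeff_def)
  qed simp
  from this[of "Suc K"] have "comb (Suc K) (next_coeff c) f = comb (Suc (Suc c)) (next_coeff c) f"
    using assms by simp
  also have "\<dots> = comb (Suc c) (next_coeff c) f + f (Suc c)"
    by (simp add: comb_Suc[of "Suc c"] next_coeff_def)
  also have "comb (Suc c) (next_coeff c) f = comb (Suc c) (q c) f"
    by (rule comb_cong) (auto simp: next_coeff_def)
  finally show ?thesis using varY_f[OF assms] by simp
qed

lemma sum_labels_reindex:
  assumes bij: "bij_betw idx {..<h} labels" and A: "\<And>t. t < h \<Longrightarrow> a t = b (idx t)"
  shows "(\<Sum>t<h. smult [:a t:] (basis_elem (idx t))) = (\<Sum>x\<in>labels. smult [:b x:] (basis_elem x))"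
proof -
  have "(\<Sum>t<h. smult [:a t:] (basis_elem (idx t))) = (\<Sum>t<h. smult [:b (idx t):] (basis_elem (idx t)))"
    by (rule sum.cong) (auto simp: A)
  also have "\<dots> = (\<Sum>x\<in>labels. smult [:b x:] (basis_elem x))"
    by (rule sum.reindex_bij_betw[OF bij])
  finally show ?thesis .
qed

text \<open>The ordering \<open>idx\<close> is left open: taking the labels by generator gives the
  Jordan form of \<open>M\<close>, by power of x the Weyr form.\<close>

lemma similar_pair_labelled:
  assumes bij: "bij_betw idx {..<h} labels"
    and A: "A \<in> carrier_mat h h" and B: "B \<in> carrier_mat h h"
    and A_eq: "\<And>l t m c m' c'. l < h \<Longrightarrow> t < h \<Longrightarrow> idx l = (m, c) \<Longrightarrow> idx t = (m', c') \<Longrightarrow>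
      A $$ (l, t) = (if m' = Suc m \<and> c' = c then 1 else 0)"
    and B_eq: "\<And>l t m c m' c'. l < h \<Longrightarrow> t < h \<Longrightarrow> idx l = (m, c) \<Longrightarrow> idx t = (m', c') \<Longrightarrow>
      B $$ (l, t) = (if m' < m then 0 else coeff (next_coeff c c') (m' - m))"
  shows "h = n \<and> similar_pair (M, N) (A, B)"
proof -
  have h: "h = n" using rows_mat_invertible[OF bij] by simp
  obtain S' where S': "S' \<in> carrier_mat n n" "rows_mat n (\<lambda>l. basis_elem (idx l)) * S' = 1\<^sub>m n"
    "S' * rows_mat n (\<lambda>l. basis_elem (idx l)) = 1\<^sub>m n" using rows_mat_invertible[OF bij] by auto
  have "similar_pair (M, N) (A, B)"
  proof (rule similar_pair_rows_mat[OF S'])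
    fix l assume l: "l < n"
    obtain m c where mc: "idx l = (m, c)" by fastforce
    have lab: "(m, c) \<in> labels" using bij_betwE[OF bij] l h mc by (metis lessThan_iff)
    then have c: "c \<le> K" "m < e c" by (auto simp: labels_def)
    \<comment> \<open>No label has \<open>c = K\<close>, because \<open>e K = 0\<close>; so the
      recursion for y f_c is available.\<close>
    then have cK: "c < K" using e_i by (cases "c = K") auto
    \<comment> \<open>If m + 1 = e c, there is no label (m + 1, c): the row of \<open>A\<close> is
      zero, and the product lies in \<open>I\<close>.\<close>
    have "smult (monom 1 1) (basis_elem (idx l)) = comb (Suc K) (\<lambda>c'. if c' = c then monom 1 (Suc m) else 0) f"
      using c by (simp add: comb_single basis_elem_def mc mult_monom)
    moreover have "(\<Sum>t<h. smult [:A $$ (l, t):] (basis_elem (idx t))) =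
        (\<Sum>x\<in>labels. smult [:coeff (if snd x = c then monom 1 (Suc m) else 0) (fst x):] (basis_elem x))"
      by (rule sum_labels_reindex[OF bij]) (use A_eq[OF _ _ mc prod.collapse[symmetric]] l h in \<open>auto simp: prod_eq_iff\<close>)
    ultimately show "smult (monom 1 1) (basis_elem (idx l)) - (\<Sum>t<n. smult [:A $$ (l, t):] (basis_elem (idx t))) \<in> I"
      using comb_minus_labels_mem[of "\<lambda>c'. if c' = c then monom 1 (Suc m) else 0"] h by simp
    have "varY * basis_elem (idx l) = comb (Suc K) (\<lambda>c'. monom 1 m * next_coeff c c') f"
      using varY_f_eq[OF cK] unfolding comb_smult by (simp add: mc basis_elem_def)
    moreover have "(\<Sum>t<h. smult [:B $$ (l, t):] (basis_elem (idx t))) =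
        (\<Sum>x\<in>labels. smult [:coeff (monom 1 m * next_coeff c (snd x)) (fst x):] (basis_elem x))"
      by (rule sum_labels_reindex[OF bij]) (use B_eq[OF _ _ mc prod.collapse[symmetric]] l h in \<open>auto simp: coeff_monom_mult\<close>)
    ultimately show "varY * basis_elem (idx l) - (\<Sum>t<n. smult [:B $$ (l, t):] (basis_elem (idx t))) \<in> I"
      using comb_minus_labels_mem[of "\<lambda>c'. monom 1 m * next_coeff c c'"] h by simp
  qed (use A B h in auto)
  then show ?thesis using h by blast
qed

end

section \<open>The Weyr form\<close>

text \<open>Such a filter keeps an initial segment. This turns the count that defines the Weyr
  characteristic into a condition on single indices.\<close>

lemma filter_downward_closed:
  assumes "\<And>c d. P d \<Longrightarrow> c \<le> d \<Longrightarrow> P c"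
  shows "c < length (filter P [0..<R]) \<longleftrightarrow> c < R \<and> P c"
proof (induction R)
  case (Suc R)
  show ?case
  proof (cases "P R")
    case True
    then have "filter P [0..<Suc R] = [0..<Suc R]" using assms by (intro filter_True) auto
    then show ?thesis using True assms by auto
  qed (use Suc less_Suc_eq in auto)
qed simp

lemma strip_decomp:
  assumes "l < (\<Sum>u = 1..k. h u)"
  obtains s a where "s \<in> {1..k}" "a < h s" "l = strip_start h s + a" "strip_of h l = s"
proof -
  have "\<exists>s \<in> {1..k}. \<exists>a < h s. l = strip_start h s + a"
    using assms
  proof (induction k)
    case (Suc k)
    show ?case
    proof (cases "l < (\<Sum>u = 1..k. h u)")
      case True
      then show ?thesis using Suc.IH by fastforce
    next
      case False
      then have "l = strip_start h (Suc k) + (l - strip_start h (Suc k))"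
        "l - strip_start h (Suc k) < h (Suc k)"
        using Suc.prems unfolding sum_eq_strip_start strip_start_Suc[of "Suc k", simplified] by auto
      then show ?thesis by (intro bexI[of _ "Suc k"]) auto
    qed
  qed simp
  then show ?thesis using that strip_of_eq by (metis atLeastAtMost_iff)
qed

lemma strip_pos_less:
  assumes "s \<in> {1..k}" "a < h s"
  shows "strip_start h s + a < (\<Sum>u = 1..k. h u)"
proof -
  have "strip_start h s + a < strip_start h (Suc s)" using assms strip_start_Suc[of s h] by simp
  also have "\<dots> \<le> strip_start h (Suc k)" using assms by (intro strip_start_mono) simp
  finally show ?thesis unfolding sum_eq_strip_start .
qed

lemma strip_of_mono:
  assumes "i \<le> j" "j < (\<Sum>u = 1..k. h u)"
  shows "strip_of h i \<le> strip_of h j"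
proof -
  have "j < (\<Sum>u = 1..strip_of h j. h u)" unfolding strip_of_def by (rule LeastI, rule assms(2))
  then show ?thesis unfolding strip_of_def[of h i] using assms(1) by (intro Least_le) simp
qed

lemma block_mat_index:
  assumes "s \<in> {1..k}" "a < h s" "s' \<in> {1..k}" "a' < h s'"
  shows "block_mat h k F $$ (strip_start h s + a, strip_start h s' + a') = F s s' $$ (a, a')"
  unfolding block_mat_def
  using strip_pos_less[of s k a h] strip_pos_less[of s' k a' h] assms by (simp add: strip_of_eq)

lemma block_mat_carrier: "block_mat h k F \<in> carrier_mat (\<Sum>u = 1..k. h u) (\<Sum>u = 1..k. h u)"
  by (simp add: block_mat_def)

lemma block_mat_cong:
  assumes "\<And>s s' a a'. s \<in> {1..k} \<Longrightarrow> s' \<in> {1..k} \<Longrightarrow> a < h s \<Longrightarrow> a' < h s' \<Longrightarrow>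
    F s s' $$ (a, a') = G s s' $$ (a, a')"
  shows "block_mat h k F = block_mat h k G"
proof (rule eq_matI)
  fix i j assume ij: "i < dim_row (block_mat h k G)" "j < dim_col (block_mat h k G)"
  then have "i < (\<Sum>u = 1..k. h u)" "j < (\<Sum>u = 1..k. h u)" by (simp_all add: block_mat_def)
  then show "block_mat h k F $$ (i, j) = block_mat h k G $$ (i, j)"
    by (elim strip_decomp) (use assms in \<open>simp add: block_mat_index\<close>)
qed (simp_all add: block_mat_def)

section \<open>Jordan block lists and Jordan matrices\<close>

lemma length_jordan_blocks: "length (jordan_blocks t ks ps) = (\<Sum>u = 1..t. ps u)"
  by (induction t) (simp_all add: jordan_blocks_def)

lemma jordan_blocks_nth:
  "c < length (jordan_blocks t ks ps :: (nat \<times> 'a :: zero) list) \<Longrightarrow>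
    (jordan_blocks t ks ps :: (nat \<times> 'a) list) ! c = (ks (strip_of ps c), 0)"
proof (induction t)
  case 0
  then show ?case by (simp add: length_jordan_blocks)
next
  case (Suc t)
  have Suc_eq: "(jordan_blocks (Suc t) ks ps :: (nat \<times> 'a) list) = jordan_blocks t ks ps @ replicate (ps (Suc t)) (ks (Suc t), 0)"
    by (simp add: jordan_blocks_def)
  show ?case
  proof (cases "c < length (jordan_blocks t ks ps :: (nat \<times> 'a) list)")
    case True
    then show ?thesis using Suc.IH unfolding Suc_eq by (simp add: nth_append)
  next
    case False
    define a where "a = c - strip_start ps (Suc t)"
    have len: "length (jordan_blocks t ks ps :: (nat \<times> 'a) list) = strip_start ps (Suc t)"
      unfolding length_jordan_blocks sum_eq_strip_start ..
    have c: "c = strip_start ps (Suc t) + a" "a < ps (Suc t)"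
      using False Suc.prems unfolding a_def Suc_eq len by (auto simp: len)
    have "strip_of ps c = Suc t" unfolding c(1) by (rule strip_of_eq) (use c in auto)
    then show ?thesis using False c unfolding Suc_eq by (simp add: nth_append len)
  qed
qed

text \<open>The labels in Jordan order: all powers of x on one generator, then those on the
  next.\<close>

definition label_list :: "(nat \<Rightarrow> nat) \<Rightarrow> nat list \<Rightarrow> (nat \<times> nat) list" where
  "label_list e cs = concat (map (\<lambda>c. map (\<lambda>m. (m, c)) [0..<e c]) cs)"

lemma length_label_list: "length (label_list e cs) = sum_list (map e cs)"
  by (simp add: label_list_def length_concat comp_def)

lemma set_label_list: "set (label_list e cs) = {(m, c). c \<in> set cs \<and> m < e c}"
  by (auto simp: label_list_def)

lemma distinct_label_list: "distinct cs \<Longrightarrow> distinct (label_list e cs)"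
proof (induction cs)
  case (Cons c cs)
  then show ?case using set_label_list[of e cs]
    by (auto simp: label_list_def distinct_map inj_on_def)
qed (simp add: label_list_def)

text \<open>The ones of a Jordan matrix link each label to the next power of x on the same
  generator. As \<open>cs\<close> is distinct, labels in different blocks differ in their second
  component, so no link crosses blocks.\<close>

lemma jordan_matrix_index:
  assumes "distinct cs" "l < length (label_list e cs)" "t < length (label_list e cs)"
  shows "jordan_matrix (map (\<lambda>c. (e c, 0)) cs) $$ (l, t) =
    (if label_list e cs ! t = (Suc (fst (label_list e cs ! l)), snd (label_list e cs ! l)) then 1 else 0)"
  using assms
proof (induction cs arbitrary: l t)
  case Nil
  then show ?case by (simp add: label_list_def)
next
  case (Cons c cs)
  let ?L = "label_list e (c # cs)" and ?L' = "label_list e cs"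
  let ?J = "jordan_matrix (map (\<lambda>c. (e c, 0)) cs) :: 'a mat"
  have L: "?L = map (\<lambda>m. (m, c)) [0..<e c] @ ?L'" by (simp add: label_list_def)
  have len: "length ?L = e c + length ?L'" by (simp add: L)
  have nth: "?L ! x = (if x < e c then (x, c) else ?L' ! (x - e c))" for x
    by (simp add: L nth_append)
  have snd: "snd (?L' ! x) \<noteq> c" if "x < length ?L'" for x
    using nth_mem[OF that] Cons.prems(1) unfolding set_label_list by auto
  have dim: "sum_list (map fst (map (\<lambda>c. (e c, 0 :: 'a)) cs)) = length ?L'"
    by (simp add: length_label_list comp_def)
  have J: "?J \<in> carrier_mat (length ?L') (length ?L')"
    unfolding dim[symmetric] by (rule jordan_matrix_carrier)
  have "jordan_matrix (map (\<lambda>c. (e c, 0)) (c # cs)) $$ (l, t) =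
      (if l < e c then if t < e c then jordan_block (e c) 0 $$ (l, t) else 0
       else if t < e c then 0 else ?J $$ (l - e c, t - e c))"
    using Cons.prems(2,3) J unfolding len list.map jordan_matrix_Cons dim
    by (auto simp: carrier_matD)
  also have "\<dots> = (if ?L ! t = (Suc (fst (?L ! l)), snd (?L ! l)) then 1 else 0)"
  proof (cases "l < e c"; cases "t < e c")
    assume lt: "\<not> l < e c" "\<not> t < e c"
    then have "?J $$ (l - e c, t - e c) = (if ?L' ! (t - e c) =
        (Suc (fst (?L' ! (l - e c))), snd (?L' ! (l - e c))) then 1 else 0)"
      using Cons.prems by (intro Cons.IH) (auto simp: len)
    then show ?thesis using lt unfolding nth by simp
  next
    assume lt: "\<not> l < e c" "t < e c"
    then have "snd (?L' ! (l - e c)) \<noteq> c" using Cons.prems(2) by (intro snd) (simp add: len)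
    then show ?thesis using lt unfolding nth by simp
  next
    assume lt: "l < e c" "\<not> t < e c"
    then have "snd (?L' ! (t - e c)) \<noteq> c" using Cons.prems(3) by (intro snd) (simp add: len)
    then show ?thesis using lt unfolding nth by (auto simp: prod_eq_iff)
  qed (auto simp: nth)
  finally show ?case .
qed

section \<open>Exponents as Jordan sizes, and the Weyr ordering of the labels\<close>

context stair_rows
begin

text \<open>Otherwise there are no labels and the dimension is 0, against
  \<open>i0 < n\<close>.\<close>

lemma e_0_pos: "0 < e 0"
proof (rule ccontr)
  assume "\<not> 0 < e 0"
  then have "e c = 0" if "c \<le> K" for c using e_antimono[of 0 c] that by simp
  then have "bij_betw (\<lambda>_. (0, 0)) {..<0 :: nat} labels" by (auto simp: labels_def bij_betw_def)
  then show False using rows_mat_invertible i0 by blast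
qed

text \<open>The number of nonzero cyclic summands, which is the number of Jordan blocks of
  \<open>M\<close>.\<close>

definition width :: nat where "width = (LEAST i. e i = 0)"

lemma width: "e c > 0 \<and> c \<le> K \<longleftrightarrow> c < width" "width \<le> K"
proof -
  have "e width = 0" unfolding width_def by (rule LeastI, rule e_i)
  show le: "width \<le> K" unfolding width_def by (rule Least_le, rule e_i)
  show "e c > 0 \<and> c \<le> K \<longleftrightarrow> c < width"
  proof (cases "c < width")
    case True
    then have "e c \<noteq> 0" unfolding width_def by (rule not_less_Least)
    then show ?thesis using True le by simp
  next
    case False
    then show ?thesis using e_antimono[of width c] \<open>e width = 0\<close> by auto
  qed
qed

text \<open>In the order of \<open>label_list\<close>, multiplication by x is a Jordan matrix; hence
  the exponents are the block sizes.\<close>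

lemma jordan_nf_e: "jordan_nf M (map (\<lambda>m. (m, 0)) (map e [0..<width]))"
proof -
  let ?L = "label_list e [0..<width]"
  let ?h = "length ?L"
  let ?J = "jordan_matrix (map (\<lambda>c. (e c, 0)) [0..<width]) :: 'a mat"
  define B where "B = mat ?h ?h (\<lambda>(l, t). if fst (?L ! t) < fst (?L ! l) then 0
    else coeff (next_coeff (snd (?L ! l)) (snd (?L ! t))) (fst (?L ! t) - fst (?L ! l)))"
  have "set ?L = labels" unfolding set_label_list labels_def by (auto simp: width(1)[symmetric])
  then have bij: "bij_betw ((!) ?L) {..<?h} labels"
    by (intro bij_betw_nth) (auto simp: distinct_label_list)
  have J: "?J \<in> carrier_mat ?h ?h"
    using jordan_matrix_carrier[of "map (\<lambda>c. (e c, 0 :: 'a)) [0..<width]"]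
    by (simp add: length_label_list comp_def)
  have "similar_pair (M, N) (?J, B)"
  proof (rule conjunct2[OF similar_pair_labelled[OF bij J]])
    show "?J $$ (l, t) = (if m' = Suc m \<and> c' = c then 1 else 0)"
      if "l < ?h" "t < ?h" "?L ! l = (m, c)" "?L ! t = (m', c')" for l t m c m' c'
      using that by (simp add: jordan_matrix_index)
  qed (auto simp: B_def)
  then have "similar_mat M ?J"
    unfolding similar_pair_def using similar_mat_sym similar_mat_def by (metis fst_conv)
  moreover have "e c \<noteq> 0" if "c < width" for c using that width(1)[of c] by auto
  ultimately show ?thesis by (force simp: jordan_nf_def comp_def)
qed

lemma sizes_eq:
  assumes "jordan_nf M (map (\<lambda>m. (m, 0)) ms)" "sorted (rev ms)"
  shows "ms = map e [0..<width]"
proof (rule jordan_sizes_unique[OF assms(1) jordan_nf_e assms(2)])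
  show "sorted (rev (map e [0..<width]))"
    unfolding sorted_rev_iff_nth_mono using e_antimono width(2) by auto
qed

text \<open>Entry (i, c) is the coefficient of x^(\<beta> - 1) f_c in y x^(\<alpha> - 1) f_i. It
  depends on \<alpha> and \<beta> only through their difference.\<close>

definition weyr_block :: "(nat \<Rightarrow> nat) \<Rightarrow> nat \<Rightarrow> nat \<Rightarrow> 'a mat" where
  "weyr_block r \<alpha> \<beta> = mat (r \<alpha>) (r \<beta>)
     (\<lambda>(i, c). if \<beta> < \<alpha> then 0 else coeff (next_coeff i c) (\<beta> - \<alpha>))"

text \<open>The hypothesis gives strip m + 1 one place for each \<open>c\<close> with m < e c, so
  label (m, c) goes to offset \<open>c\<close> there. Strips count from 1, powers of x from
  0.\<close>

lemma similar_pair_weyr: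
  assumes r: "\<And>m c. c \<le> K \<and> m < e c \<longleftrightarrow> m < k \<and> c < r (Suc m)"
  shows "(\<Sum>\<alpha> = 1..k. r \<alpha>) = n \<and> similar_pair (M, N) (weyr_mat r k, block_mat r k (weyr_block r))"
proof (rule similar_pair_labelled)
  let ?idx = "\<lambda>l. (strip_of r l - 1, l - strip_start r (strip_of r l))"
  show "bij_betw ?idx {..<\<Sum>u = 1..k. r u} labels"
  proof (rule bij_betw_byWitness[of _ "\<lambda>(m, c). strip_start r (Suc m) + c"])
    show "\<forall>l \<in> {..<\<Sum>u = 1..k. r u}. (\<lambda>(m, c). strip_start r (Suc m) + c) (?idx l) = l"
    proof
      fix l assume "l \<in> {..<\<Sum>u = 1..k. r u}"
      then obtain s a where "s \<in> {1..k}" "a < r s" "l = strip_start r s + a" "strip_of r l = s"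
        using strip_decomp[of l r k] by auto
      then show "(\<lambda>(m, c). strip_start r (Suc m) + c) (?idx l) = l" by simp
    qed
    show "\<forall>x \<in> labels. ?idx ((\<lambda>(m, c). strip_start r (Suc m) + c) x) = x"
      unfolding labels_def r by (auto simp: strip_of_eq)
    show "?idx ` {..<\<Sum>u = 1..k. r u} \<subseteq> labels"
    proof
      fix x assume "x \<in> ?idx ` {..<\<Sum>u = 1..k. r u}"
      then obtain l where "l < (\<Sum>u = 1..k. r u)" and x: "x = ?idx l" by auto
      then obtain s a where "s \<in> {1..k}" "a < r s" "l = strip_start r s + a" "strip_of r l = s"
        using strip_decomp[of l r k] by metis
      then show "x \<in> labels" unfolding labels_def r x by auto
    qed
    show "(\<lambda>(m, c). strip_start r (Suc m) + c) ` labels \<subseteq> {..<\<Sum>u = 1..k. r u}"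
      unfolding labels_def r using strip_pos_less[of _ k _ r] by auto
  qed
  show "weyr_mat r k $$ (l, t) = (if m' = Suc m \<and> c' = c then 1 else 0)"
    if l: "l < (\<Sum>u = 1..k. r u)" and t: "t < (\<Sum>u = 1..k. r u)"
      and idx: "?idx l = (m, c)" "?idx t = (m', c')" for l t m c m' c'
  proof -
    obtain s a where s: "s \<in> {1..k}" "a < r s" "l = strip_start r s + a" "strip_of r l = s"
      using strip_decomp[OF l] .
    obtain s' a' where s': "s' \<in> {1..k}" "a' < r s'" "t = strip_start r s' + a'" "strip_of r t = s'"
      using strip_decomp[OF t] .
    have "m = s - 1" "c = a" "m' = s' - 1" "c' = a'" using idx s s' by auto
    then show ?thesis unfolding weyr_mat_def s(3) s'(3) block_mat_index[OF s(1,2) s'(1,2)]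
      using s(1,2) s'(1,2) by auto
  qed
  show "block_mat r k (weyr_block r) $$ (l, t) = (if m' < m then 0 else coeff (next_coeff c c') (m' - m))"
    if l: "l < (\<Sum>u = 1..k. r u)" and t: "t < (\<Sum>u = 1..k. r u)"
      and idx: "?idx l = (m, c)" "?idx t = (m', c')" for l t m c m' c'
  proof -
    obtain s a where s: "s \<in> {1..k}" "a < r s" "l = strip_start r s + a" "strip_of r l = s"
      using strip_decomp[OF l] .
    obtain s' a' where s': "s' \<in> {1..k}" "a' < r s'" "t = strip_start r s' + a'" "strip_of r t = s'"
      using strip_decomp[OF t] .
    have "m = s - 1" "c = a" "m' = s' - 1" "c' = a'" using idx s s' by auto
    then show ?thesis unfolding weyr_block_def s(3) s'(3) block_mat_index[OF s(1,2) s'(1,2)]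
      using s(1,2) s'(1,2) by auto
  qed
  show "weyr_mat r k \<in> carrier_mat (\<Sum>\<alpha> = 1..k. r \<alpha>) (\<Sum>\<alpha> = 1..k. r \<alpha>)"
    unfolding weyr_mat_def by (rule block_mat_carrier)
qed (rule block_mat_carrier)

lemma weyr_block_index:
  "i < r \<alpha> \<Longrightarrow> c < r \<beta> \<Longrightarrow> weyr_block r \<alpha> \<beta> $$ (i, c) = (if \<beta> < \<alpha> then 0 else coeff (next_coeff i c) (\<beta> - \<alpha>))"
  by (simp add: weyr_block_def)

text \<open>Constant terms fill the diagonal blocks; by \<open>coeff_q_0\<close> only the leading
  term of the recursion contributes, whence J(0).\<close>

lemma next_coeff_0: "i < K \<Longrightarrow> coeff (next_coeff i c) 0 = (if c = Suc i then 1 else 0)"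
  using coeff_q_0 by (simp add: next_coeff_def)

lemma next_coeff_supp:
  assumes "i < K" "0 < d" "coeff (next_coeff i c) d \<noteq> 0"
  shows "e c - e i \<le> d" "d < e c - e (Suc i)"
  using assms supp[of i c d] by (auto simp: next_coeff_def split: if_splits)

end

section \<open>Uniqueness for equal block sizes\<close>

text \<open>Evaluation proceeds by Horner steps, and \<open>swap\<close> moves \<open>T\<close> past
  one step at a time.\<close>

lemma ev_intertwine:
  fixes M N M' N' :: "'a :: field mat"
  assumes "nilpotent_pair M N n K" "nilpotent_pair M' N' n K"
    and T: "T \<in> carrier_mat n n" and M: "T * M' = M * T" and N: "T * N' = N * T"
  shows "T * nilpotent_pair.ev M' N' n K p = nilpotent_pair.ev M N n K p * T"
proof -
  interpret P: nilpotent_pair M N n K by fact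
  interpret P': nilpotent_pair M' N' n K by fact
  have swap: "T * (A' * E') = A * E * T"
    if "A \<in> carrier_mat n n" "A' \<in> carrier_mat n n" "E \<in> carrier_mat n n" "E' \<in> carrier_mat n n"
      "T * A' = A * T" "T * E' = E * T" for A A' E E'
  proof -
    have "T * (A' * E') = T * A' * E'" by (rule assoc_mult_mat[symmetric, OF T that(2,4)])
    also have "\<dots> = A * (T * E')" unfolding that(5) by (rule assoc_mult_mat[OF that(1) T that(4)])
    also have "\<dots> = A * E * T" unfolding that(6) by (rule assoc_mult_mat[symmetric, OF that(1,3) T])
    finally show ?thesis .
  qed
  have const: "T * P'.ev [:h:] = P.ev [:h:] * T" for h
  proof (induction h)
    case 0
    show ?case using T by (simp add: P.ev_0 P'.ev_0)
  next
    case (pCons c h)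
    have split: "[:pCons c h:] = smult [:c:] 1 + smult (monom 1 1) [:h:]"
      by (simp add: monom_altdef one_pCons)
    have E: "P.ev [:pCons c h:] = c \<cdot>\<^sub>m 1\<^sub>m n + M * P.ev [:h:]"
      "P'.ev [:pCons c h:] = c \<cdot>\<^sub>m 1\<^sub>m n + M' * P'.ev [:h:]"
      unfolding split by (simp_all only: P.ev_add P.ev_const P.ev_X P.ev_one P'.ev_add P'.ev_const P'.ev_X P'.ev_one)
    have "T * P'.ev [:pCons c h:] = c \<cdot>\<^sub>m T + T * (M' * P'.ev [:h:])"
      unfolding E using T P'.M by (simp add: mult_add_distrib_mat[of T n n _ n] mult_smult_distrib[of T n n _ n])
    also have "T * (M' * P'.ev [:h:]) = M * P.ev [:h:] * T"
      by (rule swap) (use P.M P'.M M pCons.IH in auto)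
    also have "c \<cdot>\<^sub>m T + M * P.ev [:h:] * T = P.ev [:pCons c h:] * T"
      unfolding E using T P.M by (simp add: add_mult_distrib_mat[of _ n n _ T n] mult_smult_assoc_mat[of _ n n T n])
    finally show ?case .
  qed
  show ?thesis
  proof (induction p)
    case 0
    show ?case using T by (simp add: P.ev_0 P'.ev_0)
  next
    case (pCons h p)
    have split: "pCons h p = [:h:] + varY * p" by (simp add: varY_def)
    have "T * P'.ev (pCons h p) = T * P'.ev [:h:] + T * (N' * P'.ev p)"
      unfolding split P'.ev_add P'.ev_Y using T P'.N by (intro mult_add_distrib_mat[of _ n n _ n]) auto
    also have "T * (N' * P'.ev p) = N * P.ev p * T"
      by (rule swap) (use P.N P'.N N pCons.IH in auto)
    also have "T * P'.ev [:h:] + N * P.ev p * T = P.ev (pCons h p) * T"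
      unfolding split P.ev_add P.ev_Y const using T P.N
      by (intro add_mult_distrib_mat[of _ n n _ _ n, symmetric]) auto
    finally show ?case .
  qed
qed

text \<open>\<open>W\<close> and the rows of \<open>B\<close> before row \<open>r - 1\<close> are
  prescribed; row \<open>r - 1\<close> is the data to be recovered from the similarity
  class.\<close>

locale shift_pair = nilpotent_pair W B n K
  for W B :: "'a :: field mat" and n K +
  fixes r k :: nat
  assumes r: "0 < r" and k: "0 < k" and n: "n = k * r"
    and W_index: "l < n \<Longrightarrow> b < n \<Longrightarrow> W $$ (l, b) = (if b = l + r then 1 else 0)"
    and B_index: "Suc l < r \<Longrightarrow> b < n \<Longrightarrow> B $$ (l, b) = (if b = Suc l then 1 else 0)"
begin

lemma r_le: "r \<le> n"
  using r k n by (cases k) auto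

lemma row_mult:
  assumes A: "A \<in> carrier_mat n n" and l: "l < n" and b: "b < n"
    and unit: "\<And>x. x < n \<Longrightarrow> ev p $$ (0, x) = (if x = l then 1 else 0)"
  shows "(ev p * A) $$ (0, b) = A $$ (l, b)"
proof -
  have "(ev p * A) $$ (0, b) = (\<Sum>x<n. ev p $$ (0, x) * A $$ (x, b))"
    using A l b by (simp add: scalar_prod_def lessThan_atLeast0)
  also have "\<dots> = (\<Sum>x<n. if x = l then A $$ (x, b) else 0)"
    by (rule sum.cong) (auto simp: unit)
  finally show ?thesis using l by simp
qed

text \<open>A factor \<open>B\<close> moves the unit vector one place to the right within the first
  block, a factor \<open>W\<close> moves it one block to the right. So the first rows of the
  monomials run through all unit vectors.\<close>

lemma row_monomial:
  assumes "c < r" "m * r + c < n" "b < n"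
  shows "ev (monom (monom 1 m) c) $$ (0, b) = (if b = m * r + c then 1 else 0)"
  using assms
proof (induction m arbitrary: b)
  case 0
  then show ?case
  proof (induction c arbitrary: b)
    case 0
    then show ?case using ev_one r_le r by (simp add: monom_0 flip: one_pCons)
  next
    case (Suc c)
    have eq: "(monom (monom 1 0) (Suc c) :: 'a poly poly) = varY * monom (monom 1 0) c"
      by (simp add: varY_def monom_Suc)
    have "ev (monom (monom 1 0) (Suc c)) $$ (0, b) = B $$ (c, b)"
      unfolding eq ev_Y_right using Suc by (intro row_mult N) auto
    then show ?case using B_index Suc.prems by simp
  qed
next
  case (Suc m)
  have eq: "(monom (monom 1 (Suc m)) c :: 'a poly poly) = smult (monom 1 1) (monom (monom 1 m) c)"
    by (simp add: smult_monom mult_monom)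
  have "ev (monom (monom 1 (Suc m)) c) $$ (0, b) = W $$ (m * r + c, b)"
    unfolding eq ev_X_right using Suc by (intro row_mult M) auto
  then show ?case using W_index Suc.prems by (simp add: algebra_simps)
qed

definition unit_monom :: "nat \<Rightarrow> 'a poly poly" where
  "unit_monom b = monom (monom 1 (b div r)) (b mod r)"

lemma row_unit_monom: "b < n \<Longrightarrow> x < n \<Longrightarrow> ev (unit_monom b) $$ (0, x) = (if x = b then 1 else 0)"
  unfolding unit_monom_def using row_monomial[of "b mod r" "b div r" x] r by simp

lemma row_monom_r:
  assumes "b < n"
  shows "ev (monom 1 r) $$ (0, b) = B $$ (r - 1, b)"
proof -
  obtain r' where r': "r = Suc r'" using r by (cases r) auto
  have eq: "(monom 1 r :: 'a poly poly) = varY * monom (monom 1 0) r'"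
    by (simp add: r' varY_def monom_Suc monom_0 flip: one_pCons)
  have "ev (monom 1 r) $$ (0, b) = B $$ (r', b)"
    unfolding eq ev_Y_right
    by (rule row_mult[OF N _ assms]) (use row_monomial[of r' 0] r_le in \<open>auto simp: r'\<close>)
  then show ?thesis by (simp add: r')
qed

text \<open>Row \<open>l\<close> of \<open>ev p\<close> is row 0 of
  \<open>ev (unit_monom l) * ev p\<close>, and the two factors commute.\<close>

lemma ev_eq_0:
  assumes "\<And>b. b < n \<Longrightarrow> ev p $$ (0, b) = 0"
  shows "ev p = 0\<^sub>m n n"
proof (rule eq_matI)
  fix l b assume "l < dim_row (0\<^sub>m n n :: 'a mat)" "b < dim_col (0\<^sub>m n n :: 'a mat)"
  then have lb: "l < n" "b < n" by auto
  have "ev p $$ (l, b) = (ev (unit_monom l) * ev p) $$ (0, b)"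
    using row_mult[OF ev_carrier lb row_unit_monom[OF lb(1)]] by simp
  also have "\<dots> = (ev p * ev (unit_monom l)) $$ (0, b)" by (simp add: ev_commute)
  also have "\<dots> = 0" using assms lb by (simp add: scalar_prod_def)
  finally show "ev p $$ (l, b) = 0\<^sub>m n n $$ (l, b)" using lb by simp
qed auto

text \<open>y^r minus a candidate expansion in the monomials x^m y^c with m < k and c < r. It
  annihilates the pair when \<open>a\<close> is row \<open>r - 1\<close> of
  \<open>B\<close>.\<close>

definition char_rel :: "(nat \<Rightarrow> 'a) \<Rightarrow> 'a poly poly" where
  "char_rel a = monom 1 r + (\<Sum>b<n. smult [:- a b:] (unit_monom b))"

lemma row_char_rel:
  assumes "x < n"
  shows "ev (char_rel a) $$ (0, x) = B $$ (r - 1, x) - a x"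
proof -
  have "ev (smult [:- a b:] (unit_monom b)) $$ (0, x) = (if b = x then - a b else 0)" if "b < n" for b
    using that assms by (auto simp: ev_const row_unit_monom)
  then have "ev (\<Sum>b<n. smult [:- a b:] (unit_monom b)) $$ (0, x) = (\<Sum>b<n. if b = x then - a b else 0)"
    using assms by (subst ev_sum) (auto intro!: sum.cong)
  then show ?thesis using assms by (simp add: char_rel_def ev_add row_monom_r)
qed

end

lemma shift_pair_unique:
  fixes W B B' :: "'a :: field mat"
  assumes "shift_pair W B n K r k" "shift_pair W B' n K r k"
    and T: "T \<in> carrier_mat n n" "T' \<in> carrier_mat n n" "T' * T = 1\<^sub>m n"
    and W: "T * W = W * T" and BB': "T * B' = B * T" and b: "b < n"
  shows "B $$ (r - 1, b) = B' $$ (r - 1, b)"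
proof -
  interpret P: shift_pair W B n K r k by fact
  interpret P': shift_pair W B' n K r k by fact
  \<comment> \<open>\<open>char_rel\<close> depends on \<open>n\<close> and \<open>r\<close>, not on
    the matrices, so the relation read off from \<open>B\<close> can be evaluated at the pair with
    \<open>B'\<close>, where it vanishes by conjugation.\<close>
  let ?p = "P.char_rel (\<lambda>b. B $$ (r - 1, b))"
  have "P.ev ?p = 0\<^sub>m n n" by (rule P.ev_eq_0) (simp add: P.row_char_rel)
  then have 0: "T * P'.ev ?p = 0\<^sub>m n n"
    using ev_intertwine[OF P.nilpotent_pair_axioms P'.nilpotent_pair_axioms T(1) W BB'] T by simp
  have "P'.ev ?p = T' * T * P'.ev ?p" unfolding T(3) by simp
  also have "\<dots> = T' * (T * P'.ev ?p)"
    using T by (intro assoc_mult_mat) auto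
  also have "\<dots> = 0\<^sub>m n n" unfolding 0 using T by simp
  finally have "P'.ev ?p $$ (0, b) = 0" using b by simp
  then show ?thesis using P'.row_char_rel[OF b] by simp
qed

section \<open>Block Toeplitz pairs in matrix coordinates\<close>

lemma toeplitz_index:
  assumes "l < r" "l' < r" "s < k" "s' < k"
  shows "toeplitz_block_mat r k C $$ (s * r + l, s' * r + l') =
    (if s' < s then 0 else if s' = s then if l' = Suc l then 1 else 0 else C (s' - s) $$ (l, l'))"
proof -
  have "toeplitz_block_mat r k C $$ (strip_start (\<lambda>_. r) (Suc s) + l, strip_start (\<lambda>_. r) (Suc s') + l') =
      (if Suc s' < Suc s then 0\<^sub>m r r else if Suc s' = Suc s then jordan_block r 0
       else C (Suc s' - Suc s)) $$ (l, l')"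
    unfolding toeplitz_block_mat_def by (rule block_mat_index) (use assms in auto)
  then show ?thesis using assms by (simp add: strip_start_def)
qed

lemma shift_index:
  assumes "l < r" "l' < r" "s < k" "s' < k"
  shows "shift_block_mat r k $$ (s * r + l, s' * r + l') =
    (if s' = Suc s \<and> l' = l then 1 else 0)"
proof -
  have "shift_block_mat r k $$ (strip_start (\<lambda>_. r) (Suc s) + l, strip_start (\<lambda>_. r) (Suc s') + l') =
      (if Suc s' = Suc s + 1 then 1\<^sub>m r else 0\<^sub>m r r) $$ (l, l')"
    unfolding shift_block_mat_def by (rule block_mat_index) (use assms in auto)
  then show ?thesis using assms by (auto simp: strip_start_def)
qed

lemma toeplitz_carrier: "toeplitz_block_mat r k C \<in> carrier_mat (k * r) (k * r)"
  unfolding toeplitz_block_mat_def using block_mat_carrier[of "\<lambda>_. r" k] by simp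

lemma shift_carrier: "shift_block_mat r k \<in> carrier_mat (k * r) (k * r)"
  unfolding shift_block_mat_def using block_mat_carrier[of "\<lambda>_. r" k] by simp

lemma div_mod_decomp:
  assumes "b < k * (r :: nat)"
  shows "b = b div r * r + b mod r" "b mod r < r" "b div r < k"
  using assms by (auto simp: less_mult_imp_div_less) (cases "r = 0", auto)

lemma last_row_toeplitz_shift_pair:
  fixes B :: "'a :: field mat"
  assumes B: "last_row_toeplitz r k B" and rk: "0 < r" "0 < k"
    and P: "nilpotent_pair (shift_block_mat r k) B (k * r) K"
  shows "shift_pair (shift_block_mat r k) B (k * r) K r k"
proof (intro shift_pair.intro shift_pair_axioms.intro P rk refl)
  obtain C where C: "B = toeplitz_block_mat r k C"
    and 0: "\<And>i a b. i \<in> {1..k - 1} \<Longrightarrow> a + 1 < r \<Longrightarrow> b < r \<Longrightarrow> C i $$ (a, b) = 0"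
    using B by (auto simp: last_row_toeplitz_def)
  show "shift_block_mat r k $$ (l, b) = (if b = l + r then 1 else (0 :: 'a))" if "l < k * r" "b < k * r" for l b
  proof -
    have iff: "b = l + r \<longleftrightarrow> b div r = Suc (l div r) \<and> b mod r = l mod r"
    proof
      assume "b div r = Suc (l div r) \<and> b mod r = l mod r"
      then have "b = Suc (l div r) * r + l mod r" using div_mult_mod_eq[of b r] by simp
      then show "b = l + r" by (simp add: algebra_simps)
    qed (use rk in simp)
    show ?thesis
      using shift_index[OF div_mod_decomp(2)[OF that(1)] div_mod_decomp(2)[OF that(2)]
          div_mod_decomp(3)[OF that(1)] div_mod_decomp(3)[OF that(2)]] unfolding iff
      by simp
  qed
  show "B $$ (l, b) = (if b = Suc l then 1 else 0)" if l: "Suc l < r" and b: "b < k * r" for l b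
  proof -
    have "B $$ (0 * r + l, b div r * r + b mod r) = (if b div r = 0 then if b mod r = Suc l then 1 else 0 else C (b div r) $$ (l, b mod r))"
      unfolding C using l rk div_mod_decomp[OF b] by (subst toeplitz_index) auto
    moreover have "b div r \<noteq> 0 \<Longrightarrow> C (b div r) $$ (l, b mod r) = 0"
      using l div_mod_decomp[OF b] by (intro 0) auto
    moreover have "b = Suc l \<longleftrightarrow> b div r = 0 \<and> b mod r = Suc l"
      using l by (metis add_0 div_less div_mult_mod_eq mod_less mult_0)
    ultimately show ?thesis by auto
  qed
qed

text \<open>Composing the two similarities gives a matrix that commutes with \<open>W\<close> and
  conjugates \<open>B'\<close> into \<open>B\<close>, so their rows \<open>r - 1\<close> agree. That
  row contains the last rows of all the blocks, and their other rows are zero.\<close>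

lemma last_row_toeplitz_unique:
  fixes M N :: "'a :: field mat"
  assumes comm: "M * N = N * M" and nil: "nilpotent_mat M" "nilpotent_mat N"
    and B: "last_row_toeplitz r k B" and B': "last_row_toeplitz r k B'"
    and sim: "similar_pair (M, N) (shift_block_mat r k, B)"
    and sim': "similar_pair (M, N) (shift_block_mat r k, B')"
  shows "B = B'"
proof -
  let ?n = "k * r"
  let ?W = "shift_block_mat r k :: 'a mat"
  obtain C where C: "B = toeplitz_block_mat r k C"
    and zero_C: "\<And>i a b. i \<in> {1..k - 1} \<Longrightarrow> a + 1 < r \<Longrightarrow> b < r \<Longrightarrow> C i $$ (a, b) = 0"
    using B by (auto simp: last_row_toeplitz_def)
  obtain C' where C': "B' = toeplitz_block_mat r k C'"
    and zero_C': "\<And>i a b. i \<in> {1..k - 1} \<Longrightarrow> a + 1 < r \<Longrightarrow> b < r \<Longrightarrow> C' i $$ (a, b) = 0"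
    using B' by (auto simp: last_row_toeplitz_def)
  obtain S S' where S: "similar_mat_wit ?W M S' S" "similar_mat_wit B N S' S"
    using sim by (auto simp: similar_pair_def)
  obtain R R' where R: "similar_mat_wit ?W M R' R" "similar_mat_wit B' N R' R"
    using sim' by (auto simp: similar_pair_def)
  show ?thesis
  proof (cases "0 < r \<and> 0 < k")
    case False
    then show ?thesis using toeplitz_carrier[of r k C] toeplitz_carrier[of r k C'] unfolding C C'
      by (intro eq_matI) auto
  next
    case True
    note W = shift_carrier[of r k, where 'a = 'a]
    have BB': "B \<in> carrier_mat ?n ?n" "B' \<in> carrier_mat ?n ?n"
      unfolding C C' by (rule toeplitz_carrier)+
    note carr = similar_mat_witD2(5)[OF W S(1)] similar_mat_witD2(5)[OF BB'(1) S(2)]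
    obtain a b where ab: "M ^\<^sub>m a = 0\<^sub>m ?n ?n" "N ^\<^sub>m b = 0\<^sub>m ?n ?n"
      using nil carr by (auto simp: nilpotent_mat_def)
    define K where "K = Suc (a + b)"
    have MK: "M ^\<^sub>m K = 0\<^sub>m ?n ?n" "N ^\<^sub>m K = 0\<^sub>m ?n ?n"
      using pow_mat_nilpotent_mono[OF carr(1) ab(1), of K] pow_mat_nilpotent_mono[OF carr(2) ab(2), of K]
      by (auto simp: K_def)
    \<comment> \<open>\<open>W\<close> and \<open>A\<close> inherit commutation and the exponent
      \<open>K\<close> from \<open>M\<close> and \<open>N\<close> by conjugation.\<close>
    have nilpair: "nilpotent_pair ?W A ?n K"
      if wit: "similar_mat_wit ?W M Q' Q" "similar_mat_wit A N Q' Q" for A Q Q'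
    proof -
      note 1 = similar_mat_witD2[OF W wit(1)]
      have dim: "?n = dim_row A"
        using carrier_matD(1)[OF similar_mat_witD(5)[OF refl wit(2)]] carrier_matD(1)[OF carr(2)] by simp
      note A = similar_mat_witD(4)[OF dim wit(2)]
      note 2 = similar_mat_witD2[OF A wit(2)]
      have mult: "(Q' * X * Q) * (Q' * Y * Q) = Q' * (X * Y) * Q"
        if "X \<in> carrier_mat ?n ?n" "Y \<in> carrier_mat ?n ?n" for X Y
      proof -
        have QX: "Q' * X \<in> carrier_mat ?n ?n" and YQ: "Y * Q \<in> carrier_mat ?n ?n"
          using that 1(6,7) by auto
        have "(Q' * X * Q) * (Q' * Y * Q) = Q' * X * (Q * (Q' * (Y * Q)))"
          unfolding assoc_mult_mat[OF 1(6) that(2) 1(7)]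
          by (rule assoc_mult_mat[OF QX 1(7) mult_carrier_mat[OF 1(6) YQ]])
        also have "Q * (Q' * (Y * Q)) = Y * Q"
          unfolding assoc_mult_mat[OF 1(7,6) YQ, symmetric] 1(2) by (rule left_mult_one_mat[OF YQ])
        also have "Q' * X * (Y * Q) = Q' * (X * (Y * Q))"
          by (rule assoc_mult_mat[OF 1(6) that(1) YQ])
        also have "\<dots> = Q' * (X * Y) * Q"
          unfolding assoc_mult_mat[OF that 1(7), symmetric]
          by (rule assoc_mult_mat[symmetric, OF 1(6) _ 1(7)]) (use that in simp)
        finally show ?thesis .
      qed
      have "(Q' * M * Q) * (Q' * N * Q) = (Q' * N * Q) * (Q' * M * Q)"
        unfolding mult[OF carr(1,2)] mult[OF carr(2,1)] comm ..
      then have "?W * A = A * ?W" unfolding 1(3)[symmetric] 2(3)[symmetric] .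
      moreover have "?W ^\<^sub>m K = 0\<^sub>m ?n ?n" "A ^\<^sub>m K = 0\<^sub>m ?n ?n"
        unfolding similar_mat_wit_pow_id[OF wit(1)] similar_mat_wit_pow_id[OF wit(2)] MK
        using 1(6,7) by simp_all
      ultimately show ?thesis
        by unfold_locales (use W A in \<open>auto simp: K_def\<close>)
    qed
    have P: "shift_pair ?W B ?n K r k" "shift_pair ?W B' ?n K r k"
      by (rule last_row_toeplitz_shift_pair[OF B _ _ nilpair[OF S]]
        last_row_toeplitz_shift_pair[OF B' _ _ nilpair[OF R]]; use True in simp)+
    define T where "T = S' * R"
    define T' where "T' = R' * S"
    have wit: "similar_mat_wit ?W ?W T T'" "similar_mat_wit B B' T T'"
      unfolding T_def T'_def
      by (rule similar_mat_wit_trans[OF S(1) similar_mat_wit_sym[OF R(1)]]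
        similar_mat_wit_trans[OF S(2) similar_mat_wit_sym[OF R(2)]])+
    note 1 = similar_mat_witD2[OF W wit(1)]
    note 2 = similar_mat_witD2[OF BB'(1) wit(2)]
    have move: "T * Y = X * T" if "X = T * Y * T'" "X \<in> carrier_mat ?n ?n" "Y \<in> carrier_mat ?n ?n" for X Y
    proof -
      have "X * T = T * Y * (T' * T)"
        unfolding that(1) using that(3) 1(6,7) by (intro assoc_mult_mat) auto
      then show ?thesis unfolding 1(2) using 1(6) that(3) by simp
    qed
    have last: "B $$ (r - 1, b) = B' $$ (r - 1, b)" if "b < ?n" for b
      by (rule shift_pair_unique[OF P 1(6,7) 1(2) move[OF 1(3) W W] move[OF 2(3) BB'] that])
    have CC': "C d $$ (a, b) = C' d $$ (a, b)" if d: "d \<in> {1..k - 1}" and ab: "a < r" "b < r" for d a b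
    proof (cases "a + 1 < r")
      case True
      then show ?thesis using zero_C zero_C' d ab by simp
    next
      case False
      then have a: "a = r - 1" using ab by simp
      have dk: "d < k" using d by auto
      have "d * r + b < Suc d * r" using ab by simp
      also have "\<dots> \<le> k * r" using dk by (intro mult_le_mono1) simp
      finally have "B $$ (0 * r + a, d * r + b) = B' $$ (0 * r + a, d * r + b)"
        using last by (simp add: a)
      then show ?thesis unfolding C C'
        by (subst (asm) (1 2) toeplitz_index) (use True d dk ab in auto)
    qed
    show ?thesis unfolding C C' toeplitz_block_mat_def
      by (rule block_mat_cong) (auto intro!: CC')
  qed
qed

section \<open>Normal forms of the pair\<close>

lemma sorted_jordan_sizes:
  assumes "\<forall>s \<in> {1..t}. \<forall>s' \<in> {1..t}. s < s' \<longrightarrow> ks s' < (ks s :: nat)"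
  shows "sorted (rev (map fst (jordan_blocks t ks ps :: (nat \<times> 'a :: zero) list)))"
  unfolding sorted_rev_iff_nth_mono
proof (intro allI impI)
  let ?L = "jordan_blocks t ks ps :: (nat \<times> 'a) list"
  fix i j assume "i \<le> j" and "j < length (map fst ?L)"
  then have ij: "i \<le> j" "j < (\<Sum>u = 1..t. ps u)" by (simp_all add: length_jordan_blocks)
  have mono: "strip_of ps i \<le> strip_of ps j" by (rule strip_of_mono[OF ij])
  have "strip_of ps i \<in> {1..t}" "strip_of ps j \<in> {1..t}"
    using strip_decomp[of i ps t] strip_decomp[of j ps t] ij by (metis order.strict_trans1)+
  then have "ks (strip_of ps j) \<le> ks (strip_of ps i)"
    using assms mono by (metis le_less order_refl)
  then show "map fst ?L ! j \<le> map fst ?L ! i"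
    using ij by (simp add: jordan_blocks_nth length_jordan_blocks)
qed

lemma jordan_blocks_eq_map:
  "(jordan_blocks t ks ps :: (nat \<times> 'a :: zero) list) = map (\<lambda>m. (m, 0)) (map fst (jordan_blocks t ks ps :: (nat \<times> 'a) list))"
  by (rule nth_equalityI) (simp_all add: jordan_blocks_nth)

context stair_rows
begin

text \<open>The Jordan sizes of \<open>M\<close> are the exponents \<open>e c\<close>, so
  \<open>k\<close>, \<open>r\<close> and the stairs can all be expressed by \<open>e\<close>; the
  stairs condition then becomes \<open>next_coeff_supp\<close>.\<close>

lemma weyr_form:
  fixes t :: nat and ks ps :: "nat \<Rightarrow> nat"
  assumes pos: "\<forall>s \<in> {1..t}. 0 < ks s \<and> 1 \<le> ps s"
    and desc: "\<forall>s \<in> {1..t}. \<forall>s' \<in> {1..t}. s < s' \<longrightarrow> ks s' < ks s"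
    and jnf: "jordan_nf M (jordan_blocks t ks ps)"
  defines "k \<equiv> ks 1" and "r \<equiv> weyr_char (jordan_blocks t ks ps :: (nat \<times> 'a) list)"
  shows "\<exists>B \<in> carrier_mat n n.
    similar_pair (M, N) (weyr_mat r k, B) \<and>
    (\<forall>\<alpha> \<in> {1..k}. \<forall>\<beta> \<in> {1..k}. \<beta> < \<alpha> \<longrightarrow> block_of r B \<alpha> \<beta> = 0\<^sub>m (r \<alpha>) (r \<beta>)) \<and>
    (\<forall>\<alpha> \<in> {1..k}. block_of r B \<alpha> \<alpha> = jordan_block (r \<alpha>) 0) \<and>
    (\<forall>j \<in> {2..k}. \<forall>i < r 1. \<forall>c < r j.
       block_of r B 1 j $$ (i, c) \<noteq> 0 \<longrightarrow> on_stairs ks ps r j i c) \<and>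
    (\<forall>j l. 2 \<le> j \<longrightarrow> 1 \<le> l \<longrightarrow> j + l \<le> k \<longrightarrow>
       block_of r B (1 + l) (j + l) =
         upper_left_corner (r (1 + l)) (r (j + l)) (block_of r B 1 j))"
proof -
  let ?L = "jordan_blocks t ks ps :: (nat \<times> 'a) list"
  have sizes: "map fst ?L = map e [0..<width]"
    by (rule sizes_eq) (use jnf jordan_blocks_eq_map sorted_jordan_sizes[OF desc] in \<open>metis\<close>)+
  have len: "length ?L = width" using arg_cong[OF sizes, of length] by simp
  have strip: "ks (strip_of ps c) = e c" if "c < width" for c
  proof -
    have "fst (?L ! c) = e c" using arg_cong[OF sizes, of "\<lambda>l. l ! c"] that len by simp
    then show ?thesis using that len by (simp add: jordan_blocks_nth)
  qed
  have width_pos: "0 < width" using width(1)[of 0] e_0_pos by simp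
  have k: "k = e 0"
  proof -
    have "0 < (\<Sum>u = 1..t. ps u)" using len width_pos unfolding length_jordan_blocks by simp
    then have "1 \<in> {1..t}" by (cases t) auto
    then have "1 \<le> ps 1" using pos by blast
    then have "strip_of ps (strip_start ps 1 + 0) = 1" by (intro strip_of_eq) auto
    then have "strip_of ps 0 = 1" by (simp add: strip_start_def)
    then show ?thesis using strip[OF width_pos] by (simp add: k_def)
  qed
  have r_less: "c < r \<alpha> \<longleftrightarrow> c < width \<and> \<alpha> \<le> e c" for c \<alpha>
  proof -
    have "r \<alpha> = length (filter (\<lambda>m. \<alpha> \<le> m) (map fst ?L))"
      by (simp add: r_def weyr_char_def filter_map comp_def case_prod_unfold)
    also have "\<dots> = length (filter (\<lambda>c. \<alpha> \<le> e c) [0..<width])"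
      unfolding sizes by (simp add: filter_map comp_def)
    also have "\<dots> = length (filter (\<lambda>c. c < width \<and> \<alpha> \<le> e c) [0..<width])"
      by (rule arg_cong[of _ _ length]) (rule filter_cong, auto)
    also have "c < \<dots> \<longleftrightarrow> c < width \<and> c < width \<and> \<alpha> \<le> e c"
    proof (rule filter_downward_closed)
      fix c d assume "d < width \<and> \<alpha> \<le> e d" "c \<le> d"
      then show "c < width \<and> \<alpha> \<le> e c"
        using e_antimono[of c d] width(2) by simp
    qed
    finally show ?thesis by simp
  qed
  have cond: "c \<le> K \<and> m < e c \<longleftrightarrow> m < k \<and> c < r (Suc m)" for m c
    unfolding r_less k using e_antimono[of 0 c] width(1)[of c] by auto
  have r_mono: "r \<beta> \<le> r \<alpha>" if "\<alpha> \<le> \<beta>" for \<alpha> \<beta>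
  proof (rule ccontr)
    assume "\<not> r \<beta> \<le> r \<alpha>"
    then show False using r_less[of "r \<alpha>" \<beta>] r_less[of "r \<alpha>" \<alpha>] that by simp
  qed
  define B where "B = block_mat r k (weyr_block r)"
  have sim: "(\<Sum>\<alpha> = 1..k. r \<alpha>) = n" "similar_pair (M, N) (weyr_mat r k, B)"
    using similar_pair_weyr[OF cond] by (simp_all add: B_def)
  have "B \<in> carrier_mat n n" unfolding B_def sim(1)[symmetric] by (rule block_mat_carrier)
  have block: "block_of r B \<alpha> \<beta> = weyr_block r \<alpha> \<beta>" if "\<alpha> \<in> {1..k}" "\<beta> \<in> {1..k}" for \<alpha> \<beta>
    unfolding B_def by (rule block_of_block_mat[OF that]) (simp add: weyr_block_def)
  have less_K: "i < K" if "i < r \<alpha>" for i \<alpha>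
    using that r_less width(2) by (meson order.strict_trans2)
  have lower: "block_of r B \<alpha> \<beta> = 0\<^sub>m (r \<alpha>) (r \<beta>)" if "\<alpha> \<in> {1..k}" "\<beta> \<in> {1..k}" "\<beta> < \<alpha>" for \<alpha> \<beta>
    unfolding block[OF that(1,2)] by (rule eq_matI) (use that in \<open>auto simp: weyr_block_def\<close>)
  have diag: "block_of r B \<alpha> \<alpha> = jordan_block (r \<alpha>) 0" if "\<alpha> \<in> {1..k}" for \<alpha>
    unfolding block[OF that that]
    by (rule eq_matI) (use next_coeff_0 less_K in \<open>auto simp: weyr_block_def\<close>)
  have stairs: "on_stairs ks ps r j i c"
    if j: "j \<in> {2..k}" and i: "i < r 1" and c: "c < r j" and nz: "block_of r B 1 j $$ (i, c) \<noteq> 0" for j i c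
  proof -
    have "coeff (next_coeff i c) (j - 1) \<noteq> 0"
      using nz j i c by (subst (asm) block) (auto simp: weyr_block_index)
    \<comment> \<open>The first bound says that (i, c) is free. The second says that row i + 1 is
      not free in column c, and neither is any later row, since \<open>e\<close> decreases.\<close>
    then have supp: "e c - e i \<le> j - 1" "j - 1 < e c - e (Suc i)"
      using next_coeff_supp[OF less_K[OF i], of "j - 1" c] j by auto
    have cw: "c < width" using c r_less by simp
    have free: "free_position ks ps r j x c \<longleftrightarrow> x < width \<and> int (e c) - int (e x) \<le> int j - 1" for x
    proof (cases "x < width")
      case True
      then have "x < r 1" using r_less[of x 1] width(1)[of x] by simp
      then show ?thesis using True c by (simp add: free_position_def strip cw)
    qed (use r_less[of x 1] in \<open>simp add: free_position_def\<close>)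
    have "\<not> free_position ks ps r j x c" if "i < x" for x
    proof
      assume "free_position ks ps r j x c"
      then have x: "x < width" "int (e c) - int (e x) \<le> int j - 1" unfolding free by auto
      have "e x \<le> e (Suc i)" using e_antimono[of "Suc i" x] that x(1) width(2) by simp
      then show False using x(2) supp(2) j by simp
    qed
    moreover have "free_position ks ps r j i c" unfolding free using i r_less[of i 1] supp(1) j by auto
    ultimately show ?thesis by (simp add: on_stairs_def)
  qed
  have corner: "block_of r B (1 + l) (j + l) = upper_left_corner (r (1 + l)) (r (j + l)) (block_of r B 1 j)"
    if "2 \<le> j" "1 \<le> l" "j + l \<le> k" for j l
  proof -
    have le: "r (1 + l) \<le> r 1" "r (j + l) \<le> r j" by (intro r_mono; simp)+
    have F: "weyr_block r 1 j \<in> carrier_mat (r 1) (r j)" by (simp add: weyr_block_def)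
    have "upper_left_corner (r (1 + l)) (r (j + l)) (weyr_block r 1 j) =
        mat (r (1 + l)) (r (j + l)) (\<lambda>(i, c). weyr_block r 1 j $$ (i, c))"
      unfolding upper_left_corner_def lessThan_atLeast0
      using submatrix_interval[of 0 "r (1 + l)" "weyr_block r 1 j" 0 "r (j + l)"] le F by simp
    \<comment> \<open>Both blocks use the coefficient of x^(j - 1); only their sizes differ.\<close>
    also have "\<dots> = weyr_block r (1 + l) (j + l)"
      by (rule eq_matI) (use le that in \<open>auto simp: weyr_block_def\<close>)
    finally show ?thesis using that by (simp add: block)
  qed
  show ?thesis
    using \<open>B \<in> carrier_mat n n\<close> sim(2) lower diag stairs corner by (intro bexI[of _ B]) auto
qed

text \<open>The exponents equal \<open>k\<close> before index \<open>r\<close> and drop to 0 there.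
  Corrections occur only at a drop, hence only in the last row of a block.\<close>

lemma last_row_toeplitz_form:
  assumes jnf: "jordan_nf M (replicate r (k, 0))"
  shows "\<exists>B. last_row_toeplitz r k B \<and> similar_pair (M, N) (shift_block_mat r k, B)"
proof -
  have "map (\<lambda>m. (m, 0 :: 'a)) (replicate r k) = replicate r (k, 0)" by (simp add: map_replicate_const)
  then have sizes: "replicate r k = map e [0..<width]"
    using jnf by (intro sizes_eq) simp_all
  have width_r: "width = r" using arg_cong[OF sizes, of length] by simp
  have e_k: "e c = k" if "c < r" for c
    using arg_cong[OF sizes, of "\<lambda>l. l ! c"] that width_r by simp
  have cond: "c \<le> K \<and> m < e c \<longleftrightarrow> m < k \<and> c < r" for m c
    using width(1)[of c] e_k[of c] unfolding width_r by auto
  have sim: "similar_pair (M, N) (weyr_mat (\<lambda>_. r) k, block_mat (\<lambda>_. r) k (weyr_block (\<lambda>_. r)))"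
    using similar_pair_weyr[OF cond] by simp
  have shift: "weyr_mat (\<lambda>_. r) k = shift_block_mat r k"
    unfolding weyr_mat_def shift_block_mat_def by (rule block_mat_cong) auto
  define C where "C d = mat r r (\<lambda>(i, c). coeff (next_coeff i c) d)" for d
  have less_K: "i < K" if "i < r" for i using that width(2) width_r by simp
  have toeplitz: "block_mat (\<lambda>_. r) k (weyr_block (\<lambda>_. r)) = toeplitz_block_mat r k C"
    unfolding toeplitz_block_mat_def
    by (rule block_mat_cong) (use next_coeff_0 less_K in \<open>auto simp: weyr_block_index C_def\<close>)
  have "C i $$ (a, b) = 0" if "i \<in> {1..k - 1}" "a + 1 < r" "b < r" for i a b
  proof (rule ccontr)
    assume "C i $$ (a, b) \<noteq> 0"
    then have "coeff (next_coeff a b) i \<noteq> 0" using that by (simp add: C_def)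
    then show False
      using next_coeff_supp(2)[of a i b] less_K[of a] that e_k by simp
  qed
  then have "last_row_toeplitz r k (toeplitz_block_mat r k C)"
    unfolding last_row_toeplitz_def by (intro exI[of _ C]) (auto simp: C_def)
  then show ?thesis using sim unfolding shift toeplitz by blast
qed

end

theorem theorem2:
  fixes M N :: "'a :: field mat" and n :: nat
  assumes "M \<in> carrier_mat n n" and "N \<in> carrier_mat n n"
    and "M * N = N * M"
    and "nilpotent_mat M" and "nilpotent_mat N"
    and "subspace_dim n (common_null_space M N) = 1"
  shows
    "(\<forall>(t :: nat) (ks :: nat \<Rightarrow> nat) (ps :: nat \<Rightarrow> nat).
        (\<forall>s \<in> {1..t}. 0 < ks s \<and> 1 \<le> ps s) \<longrightarrow>
        (\<forall>s \<in> {1..t}. \<forall>s' \<in> {1..t}. s < s' \<longrightarrow> ks s' < ks s) \<longrightarrow>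
        jordan_nf M (jordan_blocks t ks ps) \<longrightarrow>
        (let k = ks 1;
             r = weyr_char (jordan_blocks t ks ps :: (nat \<times> 'a) list);
             W = weyr_mat r k
         in \<exists>B \<in> carrier_mat n n.
              similar_pair (M, N) (W, B) \<and>
              (\<forall>\<alpha> \<in> {1..k}. \<forall>\<beta> \<in> {1..k}. \<beta> < \<alpha> \<longrightarrow> block_of r B \<alpha> \<beta> = 0\<^sub>m (r \<alpha>) (r \<beta>)) \<and>
              (\<forall>\<alpha> \<in> {1..k}. block_of r B \<alpha> \<alpha> = jordan_block (r \<alpha>) 0) \<and>
              (\<forall>j \<in> {2..k}. \<forall>i < r 1. \<forall>c < r j.
                 block_of r B 1 j $$ (i, c) \<noteq> 0 \<longrightarrow> on_stairs ks ps r j i c) \<and>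
              (\<forall>j l. 2 \<le> j \<longrightarrow> 1 \<le> l \<longrightarrow> j + l \<le> k \<longrightarrow>
                 block_of r B (1 + l) (j + l) =
                   upper_left_corner (r (1 + l)) (r (j + l)) (block_of r B 1 j))))
     \<and>
     (\<forall>r k :: nat.
        jordan_nf M (replicate r (k, 0)) \<longrightarrow>
        (\<exists>B. last_row_toeplitz r k B \<and> similar_pair (M, N) (shift_block_mat r k, B)) \<and>
        (CHAR('a) = 0 \<longrightarrow>
          (\<forall>B B'. last_row_toeplitz r k B \<longrightarrow> last_row_toeplitz r k B' \<longrightarrow>
             similar_pair (M, N) (shift_block_mat r k, B) \<longrightarrow>
             similar_pair (M, N) (shift_block_mat r k, B') \<longrightarrow> B = B')))"
proof -
  obtain K i0 f e q where "stair_rows M N n K i0 f e q"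
    using stair_rows_exists[OF assms] by blast
  then interpret stair_rows M N n K i0 f e q .
  show ?thesis
    unfolding Let_def
    by (intro conjI allI impI;
        (rule weyr_form | rule last_row_toeplitz_form | rule last_row_toeplitz_unique[OF assms(3-5)]);
        assumption)
qed

end
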